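(* Let $GL$ be a non-empty connected generalized line graph. Then the following are equivalent: (1) $GL$ is Hoffman colorable and $\lambda_{\min}(GL)=-2$; (2) $GL$ is a chromatically balanced generalized line graph.
   Context: Graphs are finite and simple; $\lambda_{\max},\lambda_{\min}$ are the largest/smallest adjacency eigenvalues. A graph $G$ with at least one edge is Hoffman colorable if $\chi(G)=1-\lambda_{\max}(G)/\lambda_{\min}(G)$. $CP(m)$ denotes the complete multipartite graph with $m$ parts of size $2$. For a graph $G$ with vertices $v_1,\dots,v_n$ and nonnegative integers $a_1,\dots,a_n$, $L(G;a_1,\dots,a_n)$ is obtained from the disjoint union of the line graph $L(G)$ and $CP(a_1),\dots,CP(a_n)$ by joining every vertex of the $i$-th cocktail party graph to every vertex of $L(G)$ that is an edge of $G$ incident with $v_i$; a generalized line graph is a graph isomorphic to such a graph. For an integer $c\ge \chi(L(G))$, $L(G,c)=L(G;c-\deg v_1,\dots,c-\deg v_n)$, and a chromatically balanced generalized line graph is a graph isomorphic to $L(G,c)$ for some graph $G$ and integer $c\ge\chi(L(G))$. *)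

theory Defs
  imports
    "Graph_Theory.Graph_Theory"
    "Jordan_Normal_Form.Spectral_Radius"
begin

text \<open>
  A finite simple graph is a \<open>pair_graph\<close>: a finite, loop-free, symmetric relation on a finite
  vertex set. An undirected edge between \<open>u\<close> and \<open>v\<close> is the pair of arcs \<open>(u, v)\<close>, \<open>(v, u)\<close>, so
  the degree of a vertex is its \<open>out_degree\<close>. Library notions for general digraphs apply through the
  coercion \<open>with_proj\<close>.
\<close>

subsection \<open>Adjacency eigenvalues\<close>

text \<open>The spectrum does not depend on which enumeration of the vertices is chosen.\<close>

definition vertex_list :: "'a pair_pre_digraph \<Rightarrow> 'a list" where
  "vertex_list G = (SOME vs. distinct vs \<and> set vs = pverts G)"

definition adjacency_matrix :: "'a pair_pre_digraph \<Rightarrow> real mat" where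
  "adjacency_matrix G =
     (let vs = vertex_list G; n = length vs
      in mat n n (\<lambda>(i, j). if (vs ! i, vs ! j) \<in> parcs G then 1 else 0))"

definition lambda_max :: "'a pair_pre_digraph \<Rightarrow> real" where
  "lambda_max G = Max (spectrum (adjacency_matrix G))"

definition lambda_min :: "'a pair_pre_digraph \<Rightarrow> real" where
  "lambda_min G = Min (spectrum (adjacency_matrix G))"

subsection \<open>Hoffman colorability\<close>

definition proper_coloring :: "'a pair_pre_digraph \<Rightarrow> nat \<Rightarrow> ('a \<Rightarrow> nat) \<Rightarrow> bool" where
  "proper_coloring G k f \<longleftrightarrow>
     (\<forall>v \<in> pverts G. f v < k) \<and> (\<forall>(u, v) \<in> parcs G. f u \<noteq> f v)"

definition chromatic_number :: "'a pair_pre_digraph \<Rightarrow> nat" where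
  "chromatic_number G = (LEAST k. \<exists>f. proper_coloring G k f)"

definition hoffman_colorable :: "'a pair_pre_digraph \<Rightarrow> bool" where
  "hoffman_colorable G \<longleftrightarrow>
     parcs G \<noteq> {} \<and> real (chromatic_number G) = 1 - lambda_max G / lambda_min G"

subsection \<open>Generalized line graphs\<close>

definition edge_set :: "'a pair_pre_digraph \<Rightarrow> 'a set set" where
  "edge_set G = {{u, v} | u v. (u, v) \<in> parcs G}"

definition line_graph :: "'a pair_pre_digraph \<Rightarrow> 'a set pair_pre_digraph" where
  "line_graph G =
     \<lparr> pverts = edge_set G,
       parcs = {(e, f). e \<in> edge_set G \<and> f \<in> edge_set G \<and> e \<noteq> f \<and> e \<inter> f \<noteq> {}} \<rparr>"

text \<open>The vertices \<open>(i, False)\<close> and \<open>(i, True)\<close> form the \<open>i\<close>-th part.\<close>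

definition cocktail_party :: "nat \<Rightarrow> (nat \<times> bool) pair_pre_digraph" where
  "cocktail_party m =
     \<lparr> pverts = {..<m} \<times> UNIV,
       parcs = {((i, b), (j, c)) | i b j c. i < m \<and> j < m \<and> i \<noteq> j} \<rparr>"

text \<open>
  \<open>Line e\<close> is the vertex of the line graph given by the edge \<open>e\<close>; \<open>Party v x\<close> is the vertex \<open>x\<close> of
  the cocktail party graph attached to \<open>v\<close>.
\<close>

datatype 'a gl_vertex = Line "'a set" | Party 'a "nat \<times> bool"

definition gen_line_graph :: "'a pair_pre_digraph \<Rightarrow> ('a \<Rightarrow> nat) \<Rightarrow> 'a gl_vertex pair_pre_digraph" where
  "gen_line_graph G a =
     \<lparr> pverts = {Line e | e. e \<in> pverts (line_graph G)}
         \<union> {Party v x | v x. v \<in> pverts G \<and> x \<in> pverts (cocktail_party (a v))},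
       parcs = {(Line e, Line f) | e f. (e, f) \<in> parcs (line_graph G)}
         \<union> {(Party v x, Party v y) | v x y. v \<in> pverts G \<and> (x, y) \<in> parcs (cocktail_party (a v))}
         \<union> {(Line e, Party v x) | e v x. e \<in> edge_set G \<and> v \<in> pverts G \<and> v \<in> e
                \<and> x \<in> pverts (cocktail_party (a v))}
         \<union> {(Party v x, Line e) | e v x. e \<in> edge_set G \<and> v \<in> pverts G \<and> v \<in> e
                \<and> x \<in> pverts (cocktail_party (a v))} \<rparr>"

text \<open>
  Up to isomorphism every finite graph has its vertices in \<open>nat\<close>, so letting the root graph \<open>G\<close>
  range over graphs on natural numbers loses nothing.
\<close>

definition is_generalized_line_graph :: "'b pair_pre_digraph \<Rightarrow> bool" where
  "is_generalized_line_graph H \<longleftrightarrow>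
     (\<exists>(G :: nat pair_pre_digraph) a. pair_graph G \<and>
        digraph_iso (with_proj H) (with_proj (gen_line_graph G a)))"

text \<open>
  Meant for \<open>c \<ge> chromatic_number (line_graph G)\<close>. The edges at a vertex are pairwise adjacent in
  the line graph, so then \<open>c\<close> is at least every degree and the subtraction does not truncate.
\<close>

definition balanced_line_graph :: "'a pair_pre_digraph \<Rightarrow> nat \<Rightarrow> 'a gl_vertex pair_pre_digraph" where
  "balanced_line_graph G c = gen_line_graph G (\<lambda>v. c - out_degree (with_proj G) v)"

definition is_chromatically_balanced :: "'b pair_pre_digraph \<Rightarrow> bool" where
  "is_chromatically_balanced H \<longleftrightarrow>
     (\<exists>(G :: nat pair_pre_digraph) c. pair_graph G \<and> c \<ge> chromatic_number (line_graph G) \<and>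
        digraph_iso (with_proj H) (with_proj (balanced_line_graph G c)))"

end

(*
  The adjacency matrix A of L(G; a) satisfies A + 2I = N^T N, where the column of an edge {u, v} is
  e_u + e_v and the columns of the two vertices of a part at v are e_v + f and e_v - f. So all
  eigenvalues are at least -2. Let w be the Perron eigenfunction and suppose that c colors meet the
  Hoffman bound 1 + lambda_max / 2. Then the vectors z_i = N w_i, with w_i the restriction of w to
  the i-th color class, satisfy |sum z_i|^2 = c * sum |z_i|^2, so they all agree. Their f-coordinate
  forces the two vertices of each part to have the same color, and their v-coordinate forces every
  color to occur at v; since the edges and parts at v are pairwise joined, deg v + a_v = c.
  Conversely, if deg v + a_v = c for all v, a c-coloring of the line graph extends to the parts. The
  weight w with value 2 on edges and 1 on the other vertices has eigenvalue 2c - 2, and the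
  difference of its restrictions to two color classes has eigenvalue -2.
*)

theory Submission
  imports Defs "HOL-Analysis.Function_Topology"
begin

section \<open>Eigenfunctions\<close>

definition adj :: "'a pair_pre_digraph \<Rightarrow> 'a \<Rightarrow> 'a \<Rightarrow> real" where
  "adj G u v = of_bool ((u, v) \<in> parcs G)"

text \<open>The zero function qualifies, and values off \<open>pverts G\<close> do not matter;
  nonvanishing is required separately. Functions on vertices keep the enumeration
  \<open>vertex_list\<close> out of the later arguments.\<close>

definition eigenfunction :: "'a pair_pre_digraph \<Rightarrow> real \<Rightarrow> ('a \<Rightarrow> real) \<Rightarrow> bool" where
  "eigenfunction G k x \<longleftrightarrow> (\<forall>u\<in>pverts G. (\<Sum>v\<in>pverts G. adj G u v * x v) = k * x u)"

lemma eigenfunctionD: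
  "eigenfunction G k x \<Longrightarrow> u \<in> pverts G \<Longrightarrow> (\<Sum>v\<in>pverts G. adj G u v * x v) = k * x u"
  by (auto simp: eigenfunction_def)

lemma vertex_list:
  assumes "finite (pverts G)"
  shows "distinct (vertex_list G)" "set (vertex_list G) = pverts G"
proof -
  have "\<exists>vs. distinct vs \<and> set vs = pverts G"
    using finite_distinct_list[OF assms] by blast
  then have "distinct (vertex_list G) \<and> set (vertex_list G) = pverts G"
    unfolding vertex_list_def by (rule someI_ex)
  then show "distinct (vertex_list G)" "set (vertex_list G) = pverts G" by auto
qed

lemma adjacency_matrix_carrier:
  "adjacency_matrix G \<in> carrier_mat (length (vertex_list G)) (length (vertex_list G))"
  by (simp add: adjacency_matrix_def Let_def)

lemma adjacency_matrix_mult_vec: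
  assumes "finite (pverts G)" and "i < length (vertex_list G)"
    and "v \<in> carrier_vec (length (vertex_list G))"
    and "\<And>j. j < length (vertex_list G) \<Longrightarrow> x (vertex_list G ! j) = vec_index v j"
  shows "vec_index (adjacency_matrix G *\<^sub>v v) i
       = (\<Sum>u\<in>pverts G. adj G (vertex_list G ! i) u * x u)"
proof -
  let ?vs = "vertex_list G"
  have "vec_index (adjacency_matrix G *\<^sub>v v) i
      = (\<Sum>j\<in>{0..<length ?vs}. adj G (?vs ! i) (?vs ! j) * x (?vs ! j))"
    using assms by (auto simp: adjacency_matrix_def Let_def scalar_prod_def adj_def of_bool_def
        intro!: sum.cong)
  also have "\<dots> = (\<Sum>u\<in>pverts G. adj G (?vs ! i) u * x u)"
    using sum.reindex_bij_betw[OF bij_betw_nth[OF vertex_list(1)[OF assms(1)] refl refl],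
        of "\<lambda>u. adj G (?vs ! i) u * x u"]
    by (simp add: vertex_list[OF assms(1)] atLeast0LessThan)
  finally show ?thesis .
qed

lemma mem_spectrum_iff:
  assumes fin: "finite (pverts G)"
  shows "k \<in> spectrum (adjacency_matrix G) \<longleftrightarrow>
    (\<exists>x. eigenfunction G k x \<and> (\<exists>u\<in>pverts G. x u \<noteq> 0))"
proof
  let ?vs = "vertex_list G" and ?A = "adjacency_matrix G"
  note vs = vertex_list[OF fin]
  have dim: "dim_row ?A = length ?vs" using adjacency_matrix_carrier[of G] by auto
  {
    assume "k \<in> spectrum ?A"
    then obtain v where v: "v \<in> carrier_vec (length ?vs)" "v \<noteq> 0\<^sub>v (length ?vs)"
        "?A *\<^sub>v v = k \<cdot>\<^sub>v v"
      by (auto simp: spectrum_def eigenvalue_def eigenvector_def dim)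
    define x where "x u = vec_index v (the_inv_into {..<length ?vs} ((!) ?vs) u)" for u
    have x: "x (?vs ! j) = vec_index v j" if "j < length ?vs" for j
      using that vs(1) by (simp add: x_def the_inv_into_f_f inj_on_nth)
    have "eigenfunction G k x"
      unfolding eigenfunction_def
    proof
      fix u assume "u \<in> pverts G"
      then obtain i where i: "i < length ?vs" "u = ?vs ! i" using vs(2) by (metis in_set_conv_nth)
      have "(\<Sum>v\<in>pverts G. adj G u v * x v) = vec_index (k \<cdot>\<^sub>v v) i"
        using adjacency_matrix_mult_vec[OF fin i(1) v(1) x] v(3) i(2) by simp
      also have "\<dots> = k * x u" using i v(1) x by simp
      finally show "(\<Sum>v\<in>pverts G. adj G u v * x v) = k * x u" .
    qed
    moreover have "\<exists>u\<in>pverts G. x u \<noteq> 0"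
    proof -
      obtain j where "j < length ?vs" "vec_index v j \<noteq> 0"
        using v(1,2) by (metis carrier_vecD eq_vecI index_zero_vec(1) index_zero_vec(2))
      then show ?thesis using x vs(2) nth_mem by metis
    qed
    ultimately show "\<exists>x. eigenfunction G k x \<and> (\<exists>u\<in>pverts G. x u \<noteq> 0)" by blast
  }
  assume "\<exists>x. eigenfunction G k x \<and> (\<exists>u\<in>pverts G. x u \<noteq> 0)"
  then obtain x u where x: "eigenfunction G k x" "u \<in> pverts G" "x u \<noteq> 0" by blast
  define v where "v = vec (length ?vs) (\<lambda>i. x (?vs ! i))"
  have v: "v \<in> carrier_vec (length ?vs)" by (simp add: v_def)
  have "?A *\<^sub>v v = k \<cdot>\<^sub>v v"
  proof (rule eq_vecI)
    fix i assume "i < dim_vec (k \<cdot>\<^sub>v v)"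
    then have i: "i < length ?vs" by (simp add: v_def)
    then have "?vs ! i \<in> pverts G" using vs(2) nth_mem by blast
    then show "vec_index (?A *\<^sub>v v) i = vec_index (k \<cdot>\<^sub>v v) i"
      using adjacency_matrix_mult_vec[OF fin i v, of x] eigenfunctionD[OF x(1)] i
      by (simp add: v_def)
  qed (simp add: v_def dim)
  moreover obtain i where "i < length ?vs" "u = ?vs ! i" using x(2) vs(2) by (metis in_set_conv_nth)
  then have "v \<noteq> 0\<^sub>v (length ?vs)" using x(3) by (auto simp: v_def dest: arg_cong[of _ _ "\<lambda>v. vec_index v i"])
  ultimately show "k \<in> spectrum ?A"
    using v by (auto simp: spectrum_def eigenvalue_def eigenvector_def dim)
qed

lemma finite_spectrum: "finite (spectrum (adjacency_matrix G))"
  using card_finite_spectrum(1)[OF adjacency_matrix_carrier] .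

section \<open>Recognizing the extreme eigenvalues\<close>

lemma lambda_min_eqI:
  assumes fin: "finite (pverts G)"
    and "eigenfunction G k x" "u \<in> pverts G" "x u \<noteq> 0"
    and least: "\<And>l y v. eigenfunction G l y \<Longrightarrow> v \<in> pverts G \<Longrightarrow> y v \<noteq> 0 \<Longrightarrow> k \<le> l"
  shows "lambda_min G = k"
  unfolding lambda_min_def using assms
  by (intro Min_eqI finite_spectrum) (auto simp: mem_spectrum_iff[OF fin])

text \<open>Scale the positive function \<open>w\<close> until it just dominates the absolute value
  of \<open>x\<close>. At a vertex where the two touch, comparing the eigenvalue equations gives
  that \<open>l\<close> is at most \<open>k\<close>.\<close>

lemma lambda_max_eqI:
  assumes fin: "finite (pverts G)" and ne: "pverts G \<noteq> {}"
    and w: "eigenfunction G k w" "\<And>u. u \<in> pverts G \<Longrightarrow> w u > 0"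
  shows "lambda_max G = k"
  unfolding lambda_max_def
proof (intro Max_eqI finite_spectrum)
  show "k \<in> spectrum (adjacency_matrix G)"
    using ne w by (force simp: mem_spectrum_iff[OF fin])
next
  fix l assume "l \<in> spectrum (adjacency_matrix G)"
  then obtain x v where x: "eigenfunction G l x" and v: "v \<in> pverts G" "x v \<noteq> 0"
    by (auto simp: mem_spectrum_iff[OF fin])
  define m where "m = Max ((\<lambda>u. \<bar>x u\<bar> / w u) ` pverts G)"
  have m: "\<bar>x u\<bar> \<le> m * w u" if "u \<in> pverts G" for u
  proof -
    have "\<bar>x u\<bar> / w u \<le> m" unfolding m_def using fin that by (intro Max_ge) auto
    then show ?thesis using w(2)[OF that] by (simp add: field_simps)
  qed
  have "m \<in> (\<lambda>u. \<bar>x u\<bar> / w u) ` pverts G" unfolding m_def using fin ne by (intro Max_in) auto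
  then obtain p where p: "p \<in> pverts G" "m = \<bar>x p\<bar> / w p" by blast
  have "0 < m * w v" using m[OF v(1)] v(2) by linarith
  then have "m > 0" using w(2)[OF v(1)] by (simp add: zero_less_mult_iff)
  have xp: "\<bar>x p\<bar> = m * w p" using p w(2)[OF p(1)] by simp
  have "l * \<bar>x p\<bar> \<le> \<bar>l * x p\<bar>"
    by (metis abs_ge_self abs_ge_zero abs_mult mult_right_mono)
  also have "\<dots> = \<bar>\<Sum>v\<in>pverts G. adj G p v * x v\<bar>" using eigenfunctionD[OF x p(1)] by simp
  also have "\<dots> \<le> (\<Sum>v\<in>pverts G. \<bar>adj G p v * x v\<bar>)" by (rule sum_abs)
  also have "\<dots> \<le> (\<Sum>v\<in>pverts G. m * (adj G p v * w v))"
    using m by (intro sum_mono) (auto simp: adj_def)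
  also have "\<dots> = m * (k * w p)"
    using eigenfunctionD[OF w(1) p(1)] by (simp add: sum_distrib_left[symmetric])
  also have "\<dots> = k * \<bar>x p\<bar>" by (simp add: xp)
  finally have "l * \<bar>x p\<bar> \<le> k * \<bar>x p\<bar>" .
  moreover have "\<bar>x p\<bar> > 0" using xp \<open>m > 0\<close> w(2)[OF p(1)] by simp
  ultimately show "l \<le> k" by simp
qed

section \<open>The Perron eigenfunction\<close>

text \<open>For small negative t a positive linear term would dominate and make the expression
  negative. This first-order condition later kills the residual of a Rayleigh maximizer.\<close>

lemma quadratic_nonneg_imp_linear_coeff_zero:
  fixes R C :: real
  assumes "\<And>t. 0 \<le> 2 * t * R + t\<^sup>2 * C" and "R \<ge> 0"
  shows "R = 0"
proof (rule ccontr)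
  assume "R \<noteq> 0"
  then have R: "R > 0" using assms(2) by simp
  define s where "s = R / (\<bar>C\<bar> + 1)"
  have s: "s > 0" "s * (\<bar>C\<bar> + 1) = R" using R by (auto simp: s_def)
  have "0 \<le> s * (s * C - 2 * R)"
    using assms(1)[of "- s"] by (simp add: algebra_simps power2_eq_square)
  then have "2 * R \<le> s * C" using s(1) by (simp add: zero_le_mult_iff)
  also have "\<dots> \<le> s * \<bar>C\<bar>" using s(1) by simp
  also have "\<dots> < R" using s by (simp add: algebra_simps)
  finally show False using R by simp
qed

lemma adj_sym: "pair_graph G \<Longrightarrow> adj G u v = adj G v u"
  unfolding adj_def using pair_sym_digraph.arcs_symmetric[of G]
    pair_graph.axioms(2)[of G] pair_pseudo_graph.axioms(2)[of G]
  by (auto simp: of_bool_def)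

lemma pair_graph_finite: "pair_graph G \<Longrightarrow> finite (pverts G)"
  by (meson pair_graph.axioms(1) pair_digraph.axioms(1) pair_fin_digraph.pair_finite_verts)

text \<open>The unit sphere of functions on the vertices is compact, so the quadratic form attains
  its maximum there; homogeneity extends the bound to all functions.\<close>

lemma adj_rayleigh_maximizer:
  assumes fin: "finite (pverts G)" and ne: "pverts G \<noteq> {}"
  shows "\<exists>z \<mu>. (\<Sum>u\<in>pverts G. (z u)\<^sup>2) = 1 \<and>
    (\<Sum>u\<in>pverts G. \<Sum>v\<in>pverts G. adj G u v * z u * z v) = \<mu> \<and>
    (\<forall>x. (\<Sum>u\<in>pverts G. \<Sum>v\<in>pverts G. adj G u v * x u * x v) \<le> \<mu> * (\<Sum>u\<in>pverts G. (x u)\<^sup>2))"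
proof -
  let ?V = "pverts G"
  define Q where "Q x = (\<Sum>u\<in>?V. \<Sum>v\<in>?V. adj G u v * x u * x v)" for x
  define S where "S x = (\<Sum>u\<in>?V. (x u)\<^sup>2)" for x :: "'a \<Rightarrow> real"
  \<comment> \<open>Functions live on the whole type, so coordinates off the vertex set are pinned
    to 0. This makes \<open>B\<close> a product of compact sets, to which Tychonoff's theorem
    applies.\<close>
  define B where "B = PiE UNIV (\<lambda>u. if u \<in> ?V then {-1..1} else {0::real})"
  have "compactin (product_topology (\<lambda>i. euclidean) UNIV) B"
    unfolding B_def by (subst compactin_PiE) auto
  then have "compact B" by (simp add: euclidean_product_topology)
  have coord: "continuous_on UNIV (\<lambda>x::'a \<Rightarrow> real. x u)" for u by simp
  have contS: "continuous_on UNIV S" unfolding S_def by (intro continuous_intros coord)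
  have contQ: "continuous_on UNIV Q" unfolding Q_def by (intro continuous_intros coord)
  let ?K = "B \<inter> {x. S x = 1}"
  have "compact ?K"
    using \<open>compact B\<close> by (intro compact_Int_closed closed_Collect_eq contS continuous_on_const)
  have inK: "(\<lambda>u. if u \<in> ?V then x u / sqrt (S x) else 0) \<in> ?K" if "S x > 0" for x
  proof -
    have "\<bar>x u\<bar> \<le> sqrt (S x)" if "u \<in> ?V" for u
    proof -
      have "(x u)\<^sup>2 \<le> S x" unfolding S_def using fin that by (intro member_le_sum) auto
      then show ?thesis by (metis real_sqrt_abs real_sqrt_le_mono)
    qed
    then have "x u / sqrt (S x) \<in> {-1..1}" if "u \<in> ?V" for u
      using that \<open>S x > 0\<close> by (auto simp: field_simps abs_le_iff minus_le_iff)
    moreover have "S (\<lambda>u. if u \<in> ?V then x u / sqrt (S x) else 0) = (\<Sum>u\<in>?V. (x u)\<^sup>2 / S x)"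
      unfolding S_def[of "\<lambda>u. if u \<in> ?V then x u / sqrt (S x) else 0"]
      using \<open>S x > 0\<close> by (intro sum.cong) (auto simp: power_divide)
    moreover have "\<dots> = 1" using \<open>S x > 0\<close> by (simp add: sum_divide_distrib[symmetric] S_def)
    ultimately show ?thesis by (auto simp: B_def)
  qed
  have "S (\<lambda>_. 1) > 0" using fin ne by (simp add: S_def card_gt_0_iff)
  then have "?K \<noteq> {}" using inK by blast
  then obtain z where z: "z \<in> ?K" "\<And>x. x \<in> ?K \<Longrightarrow> Q x \<le> Q z"
    using continuous_attains_sup[OF \<open>compact ?K\<close>, of Q] continuous_on_subset[OF contQ] by blast
  have "Q x \<le> Q z * S x" for x
  proof (cases "S x > 0")
    case True
    let ?y = "\<lambda>u. if u \<in> ?V then x u / sqrt (S x) else 0"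
    have "Q ?y = (\<Sum>u\<in>?V. \<Sum>v\<in>?V. adj G u v * x u * x v / S x)"
      unfolding Q_def using True
      by (intro sum.cong refl) (auto simp: field_simps simp flip: power2_eq_square)
    also have "\<dots> = Q x / S x" by (simp add: Q_def sum_divide_distrib)
    finally show ?thesis using z(2)[OF inK[OF True]] True by (simp add: divide_le_eq)
  next
    case False
    then have "S x = 0" using sum_nonneg[of ?V "\<lambda>u. (x u)\<^sup>2"] by (simp add: S_def)
    then have "\<forall>u\<in>?V. x u = 0" using fin by (simp add: S_def sum_nonneg_eq_0_iff)
    then have "Q x = 0" by (simp add: Q_def)
    then show ?thesis using \<open>S x = 0\<close> by simp
  qed
  moreover have "S z = 1" using z(1) by simp
  ultimately show ?thesis unfolding Q_def S_def by (intro exI conjI) auto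
qed

text \<open>Adjacency entries are nonnegative, so the absolute value of a maximizer is again a
  maximizer. A maximizer is an eigenfunction because the form of \<mu> - A is positive semidefinite
  and vanishes at it.\<close>

lemma nonneg_eigenfunction_exists:
  assumes "pair_graph G" and ne: "pverts G \<noteq> {}"
  obtains w \<mu> where "eigenfunction G \<mu> w" "\<And>u. w u \<ge> 0" "\<exists>u\<in>pverts G. w u > 0"
proof -
  let ?V = "pverts G"
  have fin: "finite ?V" using pair_graph_finite[OF assms(1)] .
  obtain z \<mu> where z: "(\<Sum>u\<in>?V. (z u)\<^sup>2) = 1"
    "(\<Sum>u\<in>?V. \<Sum>v\<in>?V. adj G u v * z u * z v) = \<mu>"
    and max: "\<And>x. (\<Sum>u\<in>?V. \<Sum>v\<in>?V. adj G u v * x u * x v) \<le> \<mu> * (\<Sum>u\<in>?V. (x u)\<^sup>2)"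
    using adj_rayleigh_maximizer[OF fin ne] by auto
  define w where "w u = \<bar>z u\<bar>" for u
  \<comment> \<open>\<open>L\<close> is the operator \<mu> - A and \<open>P\<close> its quadratic
    form, nonnegative by the maximality of \<mu>.\<close>
  define L where "L x u = \<mu> * x u - (\<Sum>v\<in>?V. adj G u v * x v)" for x u
  define P where "P x = (\<Sum>u\<in>?V. x u * L x u)" for x
  have P: "P x = \<mu> * (\<Sum>u\<in>?V. (x u)\<^sup>2) - (\<Sum>u\<in>?V. \<Sum>v\<in>?V. adj G u v * x u * x v)" for x
    unfolding P_def L_def
    by (simp add: algebra_simps sum_subtractf sum_distrib_left power2_eq_square)
  have Pnn: "P x \<ge> 0" for x using max[of x] by (simp add: P)
  have "(\<Sum>u\<in>?V. \<Sum>v\<in>?V. adj G u v * z u * z v) \<le> (\<Sum>u\<in>?V. \<Sum>v\<in>?V. adj G u v * w u * w v)"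
  proof (intro sum_mono)
    fix u v
    have "z u * z v \<le> w u * w v" by (metis w_def abs_ge_self abs_mult)
    then show "adj G u v * z u * z v \<le> adj G u v * w u * w v" by (auto simp: adj_def)
  qed
  then have Pw: "P w \<le> 0" using z by (simp add: P w_def)
  \<comment> \<open>The residual of \<open>w\<close> as an eigenfunction. Moving from
    \<open>w\<close> in this very direction makes the linear coefficient of \<open>P\<close> twice
    the squared norm of \<open>r\<close>, which must then vanish.\<close>
  define r where "r = L w"
  have self_adj: "(\<Sum>u\<in>?V. w u * L r u) = (\<Sum>u\<in>?V. r u * L w u)"
  proof -
    have "(\<Sum>u\<in>?V. \<Sum>v\<in>?V. w u * (adj G u v * r v)) = (\<Sum>v\<in>?V. \<Sum>u\<in>?V. w u * (adj G u v * r v))"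
      by (rule sum.swap)
    also have "\<dots> = (\<Sum>v\<in>?V. \<Sum>u\<in>?V. r v * (adj G v u * w u))"
      by (intro sum.cong refl) (simp add: adj_sym[OF assms(1)] mult_ac)
    finally show ?thesis
      by (simp add: L_def algebra_simps sum_subtractf sum_distrib_left)
  qed
  have "0 \<le> 2 * t * (\<Sum>u\<in>?V. (r u)\<^sup>2) + t\<^sup>2 * P r" for t
  proof -
    have lin: "L (\<lambda>u. w u + t * r u) u = L w u + t * L r u" for u
      by (simp add: L_def algebra_simps sum.distrib sum_distrib_left)
    have "P (\<lambda>u. w u + t * r u)
        = P w + t * (\<Sum>u\<in>?V. w u * L r u) + t * (\<Sum>u\<in>?V. r u * L w u) + t\<^sup>2 * P r"
      unfolding P_def lin
      by (simp add: algebra_simps sum.distrib sum_distrib_left power2_eq_square)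
    also have "\<dots> = P w + 2 * t * (\<Sum>u\<in>?V. (r u)\<^sup>2) + t\<^sup>2 * P r"
      unfolding self_adj by (simp add: r_def power2_eq_square)
    finally show ?thesis using Pnn[of "\<lambda>u. w u + t * r u"] Pw by linarith
  qed
  then have "(\<Sum>u\<in>?V. (r u)\<^sup>2) = 0"
    by (rule quadratic_nonneg_imp_linear_coeff_zero) (auto intro: sum_nonneg)
  then have "\<forall>u\<in>?V. r u = 0" using fin by (simp add: sum_nonneg_eq_0_iff)
  then have "eigenfunction G \<mu> w" by (auto simp: eigenfunction_def r_def L_def)
  moreover have "\<exists>u\<in>?V. w u > 0"
  proof (rule ccontr)
    assume "\<not> ?thesis"
    then have "\<forall>u\<in>?V. z u = 0" by (auto simp: w_def)
    then show False using z(1) by simp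
  qed
  ultimately show ?thesis using that[of \<mu> w] by (simp add: w_def)
qed

text \<open>Connectedness speaks of paths in the symmetric closure; a symmetric relation gains no
  arcs from it.\<close>

lemma arcs_ends_mk_symmetric_subset:
  assumes "pair_graph G"
  shows "arcs_ends (mk_symmetric (with_proj G)) \<subseteq> parcs G"
proof -
  interpret pair_graph G by fact
  show ?thesis using arcs_symmetric
    by (auto simp: mk_symmetric_def arcs_ends_def arc_to_ends_def)
qed

text \<open>Positivity spreads along arcs from one vertex with positive value, and connectivity
  carries it to every vertex.\<close>

lemma positive_eigenfunction_exists:
  assumes "pair_graph G" and conn: "Digraph_Component.connected (with_proj G)"
  obtains w \<mu> where "eigenfunction G \<mu> w" "\<And>u. u \<in> pverts G \<Longrightarrow> w u > 0"
proof -
  let ?V = "pverts G"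
  interpret pair_graph G by fact
  have fin: "finite ?V" using pair_graph_finite[OF assms(1)] .
  have verts: "verts (mk_symmetric (with_proj G)) = ?V" by (simp add: mk_symmetric_def)
  have ne: "?V \<noteq> {}"
    using conn verts unfolding Digraph_Component.connected_def strongly_connected_def by metis
  obtain w \<mu> a where w: "eigenfunction G \<mu> w" "\<And>u. w u \<ge> 0" and a: "a \<in> ?V" "w a > 0"
    using nonneg_eigenfunction_exists[OF assms(1) ne] by metis
  \<comment> \<open>The neighbor sum at \<open>v\<close> equals \<open>\<mu> * w v\<close> and
    contains the positive term \<open>w u\<close>.\<close>
  have step: "w v > 0" if "(u, v) \<in> parcs G" "w u > 0" for u v
  proof -
    have uv: "u \<in> ?V" "v \<in> ?V" using that(1) wellformed' by auto
    have "w u = adj G v u * w u" using arcs_symmetric[OF that(1)] by (simp add: adj_def)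
    also have "\<dots> \<le> (\<Sum>u\<in>?V. adj G v u * w u)"
      using fin uv w(2) by (intro member_le_sum) (auto simp: adj_def)
    also have "\<dots> = \<mu> * w v" using eigenfunctionD[OF w(1) uv(2)] .
    finally have "w v \<noteq> 0" using that(2) by auto
    then show ?thesis using w(2)[of v] by simp
  qed
  have "w b > 0" if "b \<in> ?V" for b
  proof -
    have "(a, b) \<in> rtrancl_on ?V (arcs_ends (mk_symmetric (with_proj G)))"
      using conn a(1) that verts
      unfolding Digraph_Component.connected_def strongly_connected_def reachable_def by metis
    then show ?thesis
      using a step arcs_ends_mk_symmetric_subset[OF assms(1)]
      by (induction rule: rtrancl_on_induct) auto
  qed
  then show ?thesis using w(1) that by blast
qed

section \<open>Isomorphism invariance\<close>

text \<open>A library isomorphism carries separate maps for vertices, arcs, tails and heads. When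
  arcs are pairs of vertices, a single vertex bijection determines everything.\<close>

definition graph_iso :: "('a \<Rightarrow> 'b) \<Rightarrow> 'a pair_pre_digraph \<Rightarrow> 'b pair_pre_digraph \<Rightarrow> bool" where
  "graph_iso \<phi> G H \<longleftrightarrow> bij_betw \<phi> (pverts G) (pverts H) \<and>
    (\<forall>u\<in>pverts G. \<forall>v\<in>pverts G. (u, v) \<in> parcs G \<longleftrightarrow> (\<phi> u, \<phi> v) \<in> parcs H)"

text \<open>Both graphs have \<open>fst\<close> and \<open>snd\<close> as tail and head, which
  forces the arc map to act as the vertex map in each component.\<close>

lemma digraph_iso_imp_graph_iso:
  assumes "digraph_iso (with_proj G) (with_proj H)"
  obtains \<phi> where "graph_iso \<phi> G H"
proof -
  obtain f where f: "pre_digraph.digraph_isomorphism (with_proj G) f"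
    and H: "with_proj H = app_iso f (with_proj G)"
    using assms by (auto simp: digraph_iso_def)
  let ?\<phi> = "iso_verts f"
  have vH: "pverts H = ?\<phi> ` pverts G" and aH: "parcs H = iso_arcs f ` parcs G"
    and t: "iso_tail f = fst" and h: "iso_head f = snd"
    using arg_cong[OF H, of verts] arg_cong[OF H, of arcs] arg_cong[OF H, of tail]
      arg_cong[OF H, of head] by simp_all
  have wf: "wf_digraph (with_proj G)" and inj: "inj_on ?\<phi> (pverts G)"
    and arc: "\<And>e. e \<in> parcs G \<Longrightarrow> iso_arcs f e = (?\<phi> (fst e), ?\<phi> (snd e))"
    using f t h by (auto simp: pre_digraph.digraph_isomorphism_def prod_eq_iff)
  have "(u, v) \<in> parcs G" if uv: "u \<in> pverts G" "v \<in> pverts G" "(?\<phi> u, ?\<phi> v) \<in> parcs H" for u v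
  proof -
    obtain e where e: "e \<in> parcs G" "(?\<phi> u, ?\<phi> v) = iso_arcs f e" using uv(3) aH by auto
    have "fst e \<in> pverts G" "snd e \<in> pverts G"
      using wf_digraph.tail_in_verts[OF wf, of e] wf_digraph.head_in_verts[OF wf, of e] e(1) by auto
    then have "fst e = u" "snd e = v"
      using e(2) arc[OF e(1)] inj uv by (auto dest: inj_onD)
    then show ?thesis using e(1) by (metis prod.collapse)
  qed
  moreover have "(?\<phi> u, ?\<phi> v) \<in> parcs H" if "(u, v) \<in> parcs G" for u v
    using that aH arc[OF that] by force
  ultimately have "graph_iso ?\<phi> G H"
    using inj vH by (auto simp: graph_iso_def bij_betw_def)
  then show ?thesis using that by blast
qed

lemma eigenfunction_iso:
  assumes "graph_iso \<phi> G H"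
  shows "eigenfunction G k (y \<circ> \<phi>) \<longleftrightarrow> eigenfunction H k y"
proof -
  have b: "bij_betw \<phi> (pverts G) (pverts H)" using assms by (simp add: graph_iso_def)
  have "(\<Sum>v\<in>pverts G. adj G u v * (y \<circ> \<phi>) v) = (\<Sum>v\<in>pverts H. adj H (\<phi> u) v * y v)"
    if "u \<in> pverts G" for u
  proof -
    have "(\<Sum>v\<in>pverts G. adj G u v * (y \<circ> \<phi>) v) = (\<Sum>v\<in>pverts G. adj H (\<phi> u) (\<phi> v) * y (\<phi> v))"
      using assms that by (intro sum.cong) (auto simp: adj_def graph_iso_def)
    also have "\<dots> = (\<Sum>v\<in>pverts H. adj H (\<phi> u) v * y v)"
      using sum.reindex_bij_betw[OF b, of "\<lambda>v. adj H (\<phi> u) v * y v"] .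
    finally show ?thesis .
  qed
  then have "eigenfunction G k (y \<circ> \<phi>) \<longleftrightarrow>
      (\<forall>u\<in>pverts G. (\<Sum>v\<in>pverts H. adj H (\<phi> u) v * y v) = k * y (\<phi> u))"
    by (simp add: eigenfunction_def)
  also have "\<dots> \<longleftrightarrow> eigenfunction H k y"
    unfolding eigenfunction_def bij_betw_imp_surj_on[OF b, symmetric] by simp
  finally show ?thesis .
qed

lemma graph_iso_inv:
  assumes "graph_iso \<phi> G H"
  shows "graph_iso (the_inv_into (pverts G) \<phi>) H G"
proof -
  have b: "bij_betw \<phi> (pverts G) (pverts H)" using assms by (simp add: graph_iso_def)
  let ?\<psi> = "the_inv_into (pverts G) \<phi>"
  have right_inv: "\<phi> (?\<psi> u) = u" if "u \<in> pverts H" for u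
    using b that by (simp add: bij_betw_def f_the_inv_into_f)
  have \<psi>: "bij_betw ?\<psi> (pverts H) (pverts G)"
    using b by (rule bij_betw_the_inv_into)
  have "(u, v) \<in> parcs H \<longleftrightarrow> (?\<psi> u, ?\<psi> v) \<in> parcs G"
    if "u \<in> pverts H" "v \<in> pverts H" for u v
    using assms bij_betwE[OF \<psi>] that right_inv[OF that(1)] right_inv[OF that(2)]
    unfolding graph_iso_def by (metis (no_types))
  then show ?thesis using \<psi> by (simp add: graph_iso_def)
qed

lemma graph_iso_arcs_nonempty:
  assumes "graph_iso \<phi> G H" "pair_wf_digraph G" "parcs G \<noteq> {}"
  shows "parcs H \<noteq> {}"
proof -
  obtain u v where uv: "(u, v) \<in> parcs G" using assms(3) by (cases "parcs G = {}") auto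
  then have "u \<in> pverts G" "v \<in> pverts G" using pair_wf_digraph.wellformed'[OF assms(2)] by auto
  then have "(\<phi> u, \<phi> v) \<in> parcs H" using assms(1) uv by (simp add: graph_iso_def)
  then show ?thesis by auto
qed

section \<open>Colorings and cliques\<close>

lemma proper_coloring_iff:
  "proper_coloring G k f \<longleftrightarrow>
     (\<forall>v\<in>pverts G. f v < k) \<and> (\<forall>u v. (u, v) \<in> parcs G \<longrightarrow> f u \<noteq> f v)"
  by (auto simp: proper_coloring_def)

lemma proper_coloring_iso:
  assumes \<phi>: "graph_iso \<phi> G H" and wf: "pair_wf_digraph G" and f: "proper_coloring H k f"
  shows "proper_coloring G k (f \<circ> \<phi>)"
  unfolding proper_coloring_iff
proof (intro conjI ballI allI impI)
  fix v assume "v \<in> pverts G"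
  then have "\<phi> v \<in> pverts H" using \<phi> by (auto simp: graph_iso_def bij_betw_def)
  then show "(f \<circ> \<phi>) v < k" using f by (simp add: proper_coloring_iff)
next
  fix u v assume uv: "(u, v) \<in> parcs G"
  then have "(\<phi> u, \<phi> v) \<in> parcs H"
    using \<phi> pair_wf_digraph.wellformed'[OF wf uv] by (simp add: graph_iso_def)
  then show "(f \<circ> \<phi>) u \<noteq> (f \<circ> \<phi>) v" using f by (simp add: proper_coloring_iff)
qed

lemma chromatic_number_le: "proper_coloring G k f \<Longrightarrow> chromatic_number G \<le> k"
  unfolding chromatic_number_def by (rule Least_le) blast

text \<open>An injective numbering of the vertices is a proper coloring, so the \<open>LEAST\<close>
  in \<open>chromatic_number\<close> ranges over a nonempty set and is attained.\<close>

lemma chromatic_number_coloring: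
  assumes "pair_wf_digraph G" "finite (pverts G)" "\<And>u. (u, u) \<notin> parcs G"
  obtains f where "proper_coloring G (chromatic_number G) f"
proof -
  obtain f :: "'a \<Rightarrow> nat" and n where f: "f ` pverts G = {i. i < n}" "inj_on f (pverts G)"
    using finite_imp_inj_to_nat_seg[OF assms(2)] by blast
  have "proper_coloring G n f"
    using f assms(3) pair_wf_digraph.wellformed'[OF assms(1)]
    by (auto simp: proper_coloring_def dest: inj_onD)
  then have "\<exists>f. proper_coloring G n f" by blast
  then have "\<exists>f. proper_coloring G (chromatic_number G) f"
    unfolding chromatic_number_def by (rule LeastI)
  then show ?thesis using that by blast
qed

lemma proper_coloring_inj_on_clique:
  assumes f: "proper_coloring G k f" and K: "pairwise (\<lambda>u v. (u, v) \<in> parcs G) K"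
  shows "inj_on f K"
proof (rule inj_onI, rule ccontr)
  fix u v assume "u \<in> K" "v \<in> K" "f u = f v" "u \<noteq> v"
  then have "(u, v) \<in> parcs G" using K by (simp add: pairwise_def)
  then show False using f \<open>f u = f v\<close> by (simp add: proper_coloring_iff)
qed

lemma chromatic_number_ge_clique:
  assumes "proper_coloring G k f" "K \<subseteq> pverts G" "pairwise (\<lambda>u v. (u, v) \<in> parcs G) K"
  shows "card K \<le> k"
proof -
  have "f ` K \<subseteq> {..<k}" using assms(1,2) by (auto simp: proper_coloring_def)
  then show ?thesis using proper_coloring_inj_on_clique[OF assms(1,3)] card_inj_on_le[of f K "{..<k}"] by simp
qed

section \<open>Graphs with adjacency matrix plus twice the identity a Gram matrix\<close>

text \<open>Column \<open>u\<close> of \<open>N\<close> is a vector attached to the vertex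
  \<open>u\<close>, and \<open>gram\<close> says that the transpose of N times N is A + 2I. The
  lower bound -2 on eigenvalues and the equality case of the Hoffman bound are derived from this
  factorization alone.\<close>

locale gram_graph =
  fixes G :: "'a pair_pre_digraph" and C :: "'c set" and N :: "'c \<Rightarrow> 'a \<Rightarrow> real"
  assumes finite_verts: "finite (pverts G)" and finite_coords: "finite C"
    and gram: "\<And>u v. u \<in> pverts G \<Longrightarrow> v \<in> pverts G \<Longrightarrow>
      (\<Sum>c\<in>C. N c u * N c v) = adj G u v + 2 * of_bool (u = v)"
begin

definition gram_image :: "('a \<Rightarrow> real) \<Rightarrow> 'c \<Rightarrow> real" where
  "gram_image x c = (\<Sum>u\<in>pverts G. N c u * x u)"

lemma gram_apply:
  assumes "u \<in> pverts G"
  shows "(\<Sum>c\<in>C. N c u * gram_image x c) = (\<Sum>v\<in>pverts G. adj G u v * x v) + 2 * x u"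
proof -
  have "(\<Sum>c\<in>C. N c u * gram_image x c) = (\<Sum>v\<in>pverts G. (\<Sum>c\<in>C. N c u * N c v) * x v)"
    unfolding gram_image_def sum_distrib_left sum_distrib_right mult.assoc by (rule sum.swap)
  also have "\<dots> = (\<Sum>v\<in>pverts G. adj G u v * x v + 2 * of_bool (u = v) * x v)"
    using assms by (intro sum.cong refl) (simp add: gram distrib_right)
  also have "(\<Sum>v\<in>pverts G. 2 * of_bool (u = v) * x v) = (\<Sum>v\<in>pverts G. if u = v then 2 * x v else 0)"
    by (intro sum.cong) auto
  then have "(\<Sum>v\<in>pverts G. adj G u v * x v + 2 * of_bool (u = v) * x v)
      = (\<Sum>v\<in>pverts G. adj G u v * x v) + 2 * x u"
    using assms finite_verts by (simp add: sum.distrib)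
  finally show ?thesis .
qed

lemma gram_image_norm:
  "(\<Sum>c\<in>C. (gram_image x c)\<^sup>2) = (\<Sum>u\<in>pverts G. x u * ((\<Sum>v\<in>pverts G. adj G u v * x v) + 2 * x u))"
proof -
  have "(\<Sum>c\<in>C. (gram_image x c)\<^sup>2) = (\<Sum>c\<in>C. \<Sum>u\<in>pverts G. x u * (N c u * gram_image x c))"
    by (simp add: power2_eq_square gram_image_def[of x] sum_distrib_right mult_ac)
  also have "\<dots> = (\<Sum>u\<in>pverts G. x u * (\<Sum>c\<in>C. N c u * gram_image x c))"
    unfolding sum_distrib_left by (rule sum.swap)
  finally show ?thesis by (simp add: gram_apply cong: sum.cong)
qed

lemma eigenvalue_ge:
  assumes "eigenfunction G k x" "u \<in> pverts G" "x u \<noteq> 0"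
  shows "- 2 \<le> k"
proof -
  have "(\<Sum>c\<in>C. (gram_image x c)\<^sup>2) = (\<Sum>u\<in>pverts G. (k + 2) * (x u)\<^sup>2)"
    unfolding gram_image_norm using eigenfunctionD[OF assms(1)]
    by (intro sum.cong) (auto simp: algebra_simps power2_eq_square)
  then have "0 \<le> (k + 2) * (\<Sum>u\<in>pverts G. (x u)\<^sup>2)"
    by (metis sum_distrib_left sum_nonneg zero_le_power2)
  moreover have "(\<Sum>u\<in>pverts G. (x u)\<^sup>2) > 0"
    using assms finite_verts by (intro sum_pos2[of _ u]) auto
  ultimately show ?thesis by (simp add: zero_le_mult_iff)
qed

text \<open>The eigenvalue \<open>2 * real k - 2\<close> is the one for which k colors meet the
  Hoffman bound with least eigenvalue -2. The two norm evaluations \<open>sq1\<close> and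
  \<open>sq2\<close> then leave no room for the vectors \<open>Z i\<close> to differ.\<close>

lemma coloring_equitable:
  assumes w: "eigenfunction G (2 * real k - 2) w" and f: "proper_coloring G k f"
    and "c \<in> C" "i < k" "j < k"
  shows "gram_image (\<lambda>u. w u * of_bool (f u = i)) c = gram_image (\<lambda>u. w u * of_bool (f u = j)) c"
proof -
  let ?V = "pverts G"
  define Z where "Z i = gram_image (\<lambda>u. w u * of_bool (f u = i))" for i
  define W where "W = (\<Sum>u\<in>?V. (w u)\<^sup>2)"
  have split: "(\<Sum>i<k. w u * of_bool (f u = i)) = w u" if "u \<in> ?V" for u
  proof -
    have "f u < k" using f that by (simp add: proper_coloring_def)
    then show ?thesis by (simp add: sum_distrib_left[symmetric] of_bool_def)
  qed
  have sumZ: "(\<Sum>i<k. Z i c) = gram_image w c" for c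
  proof -
    have "(\<Sum>i<k. Z i c) = (\<Sum>u\<in>?V. N c u * (\<Sum>i<k. w u * of_bool (f u = i)))"
      unfolding Z_def gram_image_def sum_distrib_left by (rule sum.swap)
    also have "\<dots> = gram_image w c"
      unfolding gram_image_def by (intro sum.cong refl) (simp only: split)
    finally show ?thesis .
  qed
  \<comment> \<open>A color class is independent, so A contributes nothing and only 2I
    remains.\<close>
  have normZ: "(\<Sum>c\<in>C. (Z i c)\<^sup>2) = (\<Sum>u\<in>?V. 2 * (w u)\<^sup>2 * of_bool (f u = i))" for i
  proof -
    have "of_bool (f u = i) * (\<Sum>v\<in>?V. adj G u v * (w v * of_bool (f v = i))) = 0" for u
    proof (cases "f u = i")
      case True
      then have "adj G u v * (w v * of_bool (f v = i)) = 0" for v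
        using f by (auto simp: adj_def proper_coloring_def)
      then show ?thesis by simp
    qed simp
    then have "w u * of_bool (f u = i) * (\<Sum>v\<in>?V. adj G u v * (w v * of_bool (f v = i))) = 0" for u
      by (metis mult.assoc mult_zero_right)
    then show ?thesis
      unfolding Z_def gram_image_norm
      by (intro sum.cong) (auto simp: algebra_simps power2_eq_square)
  qed
  have "(\<Sum>i<k. \<Sum>c\<in>C. (Z i c)\<^sup>2) = (\<Sum>u\<in>?V. 2 * w u * (\<Sum>i<k. w u * of_bool (f u = i)))"
    unfolding normZ sum_distrib_left
    by (subst sum.swap) (intro sum.cong refl, simp only: power2_eq_square mult_ac)
  also have "\<dots> = (\<Sum>u\<in>?V. 2 * w u * w u)"
    by (intro sum.cong refl) (simp only: split)
  also have "\<dots> = 2 * W"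
    by (simp add: W_def sum_distrib_left power2_eq_square mult_ac)
  finally have sq1: "(\<Sum>c\<in>C. \<Sum>i<k. (Z i c)\<^sup>2) = 2 * W"
    by (subst sum.swap)
  have sq2: "(\<Sum>c\<in>C. (\<Sum>i<k. Z i c)\<^sup>2) = 2 * real k * W"
    unfolding sumZ gram_image_norm W_def sum_distrib_left
    using eigenfunctionD[OF w] by (intro sum.cong) (auto simp: algebra_simps power2_eq_square)
  \<comment> \<open>Lagrange's identity in one coordinate; summed over \<open>C\<close>, the right
    side is 0 by \<open>sq1\<close> and \<open>sq2\<close>.\<close>
  have expand: "(\<Sum>i<k. \<Sum>j<k. (Z i c - Z j c)\<^sup>2)
      = 2 * real k * (\<Sum>i<k. (Z i c)\<^sup>2) - 2 * (\<Sum>i<k. Z i c)\<^sup>2" for c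
  proof -
    have "(\<Sum>i<k. \<Sum>j<k. (Z i c - Z j c)\<^sup>2)
        = (\<Sum>i<k. \<Sum>j<k. (Z i c)\<^sup>2) + (\<Sum>i<k. \<Sum>j<k. (Z j c)\<^sup>2) - 2 * (\<Sum>i<k. \<Sum>j<k. Z i c * Z j c)"
      by (simp add: power2_diff sum.distrib sum_subtractf sum_distrib_left mult_ac)
    also have "(\<Sum>i<k. \<Sum>j<k. Z i c * Z j c) = (\<Sum>i<k. Z i c)\<^sup>2"
      by (simp add: power2_eq_square sum_product)
    finally show ?thesis by (simp add: sum_distrib_left mult.assoc)
  qed
  \<comment> \<open>Equality in the Cauchy--Schwarz inequality for the vectors \<open>Z i\<close>.\<close>
  have "(\<Sum>c\<in>C. \<Sum>i<k. \<Sum>j<k. (Z i c - Z j c)\<^sup>2) = 0"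
    by (simp add: expand sum_subtractf sum_distrib_left[symmetric] sq1 sq2)
  then have "(\<Sum>i<k. \<Sum>j<k. (Z i c - Z j c)\<^sup>2) = 0"
    using \<open>c \<in> C\<close> finite_coords by (subst (asm) sum_nonneg_eq_0_iff) (auto intro!: sum_nonneg)
  then have "(\<Sum>j<k. (Z i c - Z j c)\<^sup>2) = 0"
    using \<open>i < k\<close> by (subst (asm) sum_nonneg_eq_0_iff) (auto intro!: sum_nonneg)
  then have "(Z i c - Z j c)\<^sup>2 = 0"
    using \<open>j < k\<close> by (subst (asm) sum_nonneg_eq_0_iff) auto
  then show ?thesis by (simp add: Z_def)
qed

end

section \<open>Spectrum and Hoffman colorability under isomorphism\<close>

lemma spectrum_iso:
  assumes \<phi>: "graph_iso \<phi> G H" and fin: "finite (pverts G)"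
  shows "spectrum (adjacency_matrix G) = spectrum (adjacency_matrix H)"
proof -
  \<comment> \<open>Kept general in both graphs and their vertex types, so that it also applies to
    the inverse isomorphism.\<close>
  have mono: "k \<in> spectrum (adjacency_matrix A)"
    if f: "graph_iso f A B" and finA: "finite (pverts A)" and finB: "finite (pverts B)"
      and k: "k \<in> spectrum (adjacency_matrix B)"
    for f k and A :: "'c pair_pre_digraph" and B :: "'d pair_pre_digraph"
  proof -
    obtain x u where x: "eigenfunction B k x" "u \<in> pverts B" "x u \<noteq> 0"
      using k by (auto simp: mem_spectrum_iff[OF finB])
    obtain v where "v \<in> pverts A" "f v = u"
      using f x(2) by (metis graph_iso_def bij_betw_imp_surj_on imageE)
    then show ?thesis
      using x eigenfunction_iso[OF f, of k x] by (force simp: mem_spectrum_iff[OF finA])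
  qed
  have finH: "finite (pverts H)" using \<phi> fin by (auto simp: graph_iso_def bij_betw_finite)
  show ?thesis using mono[OF \<phi> fin finH] mono[OF graph_iso_inv[OF \<phi>] finH fin] by blast
qed

lemma chromatic_number_iso:
  assumes "graph_iso \<phi> G H" "pair_wf_digraph G" "pair_wf_digraph H"
  shows "chromatic_number G = chromatic_number H"
proof -
  have "(\<exists>f. proper_coloring G k f) \<longleftrightarrow> (\<exists>f. proper_coloring H k f)" for k
    using proper_coloring_iso[OF assms(1,2)] proper_coloring_iso[OF graph_iso_inv[OF assms(1)] assms(3)]
    by blast
  then show ?thesis by (simp add: chromatic_number_def)
qed

lemma hoffman_iso:
  assumes \<phi>: "graph_iso \<phi> G H" and G: "pair_wf_digraph G" "finite (pverts G)"
    and H: "pair_wf_digraph H"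
  shows "lambda_max G = lambda_max H" "lambda_min G = lambda_min H"
    "hoffman_colorable G \<longleftrightarrow> hoffman_colorable H"
proof -
  show max: "lambda_max G = lambda_max H" and min: "lambda_min G = lambda_min H"
    by (simp_all add: lambda_max_def lambda_min_def spectrum_iso[OF \<phi> G(2)])
  show "hoffman_colorable G \<longleftrightarrow> hoffman_colorable H"
    using graph_iso_arcs_nonempty[OF \<phi> G(1)] graph_iso_arcs_nonempty[OF graph_iso_inv[OF \<phi>] H]
      chromatic_number_iso[OF \<phi> G(1) H] max min
    by (auto simp: hoffman_colorable_def)
qed

section \<open>Generalized line graphs\<close>

lemma gen_line_graph_verts [simp]:
  "Line e \<in> pverts (gen_line_graph G a) \<longleftrightarrow> e \<in> edge_set G"
  "Party v (i, b) \<in> pverts (gen_line_graph G a) \<longleftrightarrow> v \<in> pverts G \<and> i < a v"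
  by (auto simp: gen_line_graph_def line_graph_def cocktail_party_def)

lemma gen_line_graph_arcs [simp]:
  "(Line e, Line f) \<in> parcs (gen_line_graph G a) \<longleftrightarrow>
     e \<in> edge_set G \<and> f \<in> edge_set G \<and> e \<noteq> f \<and> e \<inter> f \<noteq> {}"
  "(Line e, Party v (i, b)) \<in> parcs (gen_line_graph G a) \<longleftrightarrow>
     e \<in> edge_set G \<and> v \<in> pverts G \<and> v \<in> e \<and> i < a v"
  "(Party v (i, b), Line e) \<in> parcs (gen_line_graph G a) \<longleftrightarrow>
     e \<in> edge_set G \<and> v \<in> pverts G \<and> v \<in> e \<and> i < a v"
  "(Party v (i, b), Party u (j, c)) \<in> parcs (gen_line_graph G a) \<longleftrightarrow>
     u = v \<and> v \<in> pverts G \<and> i < a v \<and> j < a v \<and> i \<noteq> j"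
  by (auto simp: gen_line_graph_def line_graph_def cocktail_party_def)

lemma gl_vertex_cases [case_names Line Party]:
  obtains e where "p = Line e" | v i b where "p = Party v (i, b)"
  by (metis gl_vertex.exhaust surj_pair)

lemma edge_setE:
  assumes "pair_graph G" "e \<in> edge_set G"
  obtains u v where "e = {u, v}" "u \<noteq> v" "u \<in> pverts G" "v \<in> pverts G"
proof -
  interpret pair_graph G by fact
  obtain u v where "e = {u, v}" "(u, v) \<in> parcs G" using assms(2) by (auto simp: edge_set_def)
  then show ?thesis using that wellformed' no_loops' by blast
qed

lemma finite_edge_set: "pair_graph G \<Longrightarrow> finite (edge_set G)"
  by (rule finite_subset[of _ "Pow (pverts G)"]) (auto elim: edge_setE simp: pair_graph_finite)

text \<open>This is the inner product of the Gram vectors of two edges; distinct edges of a simple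
  graph share at most one vertex.\<close>

lemma card_edge_inter:
  assumes "pair_graph G" "e \<in> edge_set G" "f \<in> edge_set G"
  shows "card (e \<inter> f) = (if e = f then 2 else if e \<inter> f \<noteq> {} then 1 else 0)"
proof -
  obtain u v x y where e: "e = {u, v}" "u \<noteq> v" and f: "f = {x, y}" "x \<noteq> y"
    using edge_setE[OF assms(1,2)] edge_setE[OF assms(1,3)] by metis
  consider "e = f" | "e \<noteq> f" "e \<inter> f = {}" | z where "e \<noteq> f" "e \<inter> f = {z}"
    using e f by auto
  then show ?thesis using e by cases auto
qed

text \<open>Degrees count arcs, while the line graph has undirected edges as vertices. Each edge at
  \<open>v\<close> corresponds to the one arc along it with tail \<open>v\<close>, which symmetry
  supplies.\<close>

lemma card_incident_edges:
  assumes "pair_graph G"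
  shows "card {e \<in> edge_set G. v \<in> e} = out_degree (with_proj G) v"
proof -
  interpret pair_graph G by fact
  have "bij_betw (\<lambda>(x, y). {x, y}) {e \<in> parcs G. fst e = v} {e \<in> edge_set G. v \<in> e}"
    unfolding bij_betw_def
  proof
    show "inj_on (\<lambda>(x, y). {x, y}) {e \<in> parcs G. fst e = v}"
      by (auto simp: inj_on_def doubleton_eq_iff)
    show "(\<lambda>(x, y). {x, y}) ` {e \<in> parcs G. fst e = v} = {e \<in> edge_set G. v \<in> e}"
    proof (intro equalityI subsetI)
      fix e assume "e \<in> {e \<in> edge_set G. v \<in> e}"
      then obtain x y where "e = {x, y}" "(x, y) \<in> parcs G" "v = x \<or> v = y"
        by (auto simp: edge_set_def)
      then have "\<exists>z. e = {v, z} \<and> (v, z) \<in> parcs G" using arcs_symmetric by blast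
      then show "e \<in> (\<lambda>(x, y). {x, y}) ` {e \<in> parcs G. fst e = v}" by force
    qed (auto simp: edge_set_def)
  qed
  then show ?thesis
    using bij_betw_same_card by (fastforce simp: out_degree_def out_arcs_def)
qed

lemma gen_line_graph_wf: "pair_wf_digraph (gen_line_graph G a)"
proof
  fix x assume "x \<in> parcs (gen_line_graph G a)"
  moreover obtain p q where x: "x = (p, q)" by (cases x)
  ultimately show "fst x \<in> pverts (gen_line_graph G a)" "snd x \<in> pverts (gen_line_graph G a)"
    by (cases p rule: gl_vertex_cases; cases q rule: gl_vertex_cases; simp)+
qed

lemma gen_line_graph_loopfree: "(p, p) \<notin> parcs (gen_line_graph G a)"
  by (cases p rule: gl_vertex_cases) auto

lemma gen_line_graph_pverts:
  "pverts (gen_line_graph G a) = Line ` edge_set G \<union>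
     (\<lambda>(v, i, b). Party v (i, b)) ` (SIGMA v:pverts G. {..<a v} \<times> UNIV)"
proof -
  have "p \<in> pverts (gen_line_graph G a) \<longleftrightarrow> p \<in> Line ` edge_set G \<union>
     (\<lambda>(v, i, b). Party v (i, b)) ` (SIGMA v:pverts G. {..<a v} \<times> UNIV)" for p
    by (cases p rule: gl_vertex_cases) (auto simp: image_iff)
  then show ?thesis by blast
qed

lemma gen_line_graph_finite:
  "pair_graph G \<Longrightarrow> finite (pverts (gen_line_graph G a))"
  unfolding gen_line_graph_pverts
  by (intro finite_UnI finite_imageI finite_SigmaI finite_cartesian_product)
    (auto simp: pair_graph_finite finite_edge_set)

lemma gen_line_graph_sum:
  fixes F :: "'a gl_vertex \<Rightarrow> real"
  assumes "pair_graph G"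
  shows "(\<Sum>p\<in>pverts (gen_line_graph G a). F p) = (\<Sum>e\<in>edge_set G. F (Line e)) +
    (\<Sum>v\<in>pverts G. \<Sum>i<a v. F (Party v (i, False)) + F (Party v (i, True)))"
proof -
  let ?S = "SIGMA v:pverts G. {..<a v} \<times> (UNIV :: bool set)"
  have fin: "finite ?S" using pair_graph_finite[OF assms] by auto
  have "(\<Sum>p\<in>pverts (gen_line_graph G a). F p)
      = (\<Sum>p\<in>Line ` edge_set G. F p) + (\<Sum>p\<in>(\<lambda>(v, i, b). Party v (i, b)) ` ?S. F p)"
    unfolding gen_line_graph_pverts
    using fin finite_edge_set[OF assms] by (intro sum.union_disjoint) auto
  also have "(\<Sum>p\<in>Line ` edge_set G. F p) = (\<Sum>e\<in>edge_set G. F (Line e))"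
    by (subst sum.reindex) (auto simp: inj_on_def)
  also have "(\<Sum>p\<in>(\<lambda>(v, i, b). Party v (i, b)) ` ?S. F p) = (\<Sum>(v, i, b)\<in>?S. F (Party v (i, b)))"
    by (subst sum.reindex) (auto simp: inj_on_def intro!: sum.cong)
  also have "\<dots> = (\<Sum>v\<in>pverts G. \<Sum>(i, b)\<in>{..<a v} \<times> UNIV. F (Party v (i, b)))"
    using pair_graph_finite[OF assms] by (subst sum.Sigma) auto
  also have "\<dots> = (\<Sum>v\<in>pverts G. \<Sum>i<a v. \<Sum>b\<in>UNIV. F (Party v (i, b)))"
    by (simp add: sum.cartesian_product)
  finally show ?thesis by (simp add: UNIV_bool add.commute)
qed

subsection \<open>The Gram representation\<close>

fun at_root :: "'a \<Rightarrow> 'a gl_vertex \<Rightarrow> bool" where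
  "at_root v (Line e) \<longleftrightarrow> v \<in> e"
| "at_root v (Party u x) \<longleftrightarrow> u = v"

text \<open>
  The Gram vector of the edge \<open>{u, v}\<close> is \<open>e\<^sub>u + e\<^sub>v\<close>; the two vertices of the \<open>i\<close>-th part at \<open>v\<close>
  have the Gram vectors \<open>e\<^sub>v \<plusminus> e\<^sub>v\<^sub>,\<^sub>i\<close>. The unit vectors \<open>e\<^sub>v\<close> and \<open>e\<^sub>v\<^sub>,\<^sub>i\<close> are
  indexed by \<open>Inl v\<close> and \<open>Inr (v, i)\<close>.
\<close>

fun gl_coord :: "'a + 'a \<times> nat \<Rightarrow> 'a gl_vertex \<Rightarrow> real" where
  "gl_coord (Inl v) p = of_bool (at_root v p)"
| "gl_coord (Inr (v, i)) (Line e) = 0"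
| "gl_coord (Inr (v, i)) (Party u (j, b)) = of_bool (u = v \<and> j = i) * (if b then - 1 else 1)"

definition gl_index :: "'a pair_pre_digraph \<Rightarrow> ('a \<Rightarrow> nat) \<Rightarrow> ('a + 'a \<times> nat) set" where
  "gl_index G a = pverts G <+> (SIGMA v:pverts G. {..<a v})"

lemma gl_index_sum:
  assumes "pair_graph G"
  shows "(\<Sum>c\<in>gl_index G a. F c) =
    (\<Sum>v\<in>pverts G. F (Inl v)) + (\<Sum>v\<in>pverts G. \<Sum>i<a v. F (Inr (v, i)) :: real)"
  using pair_graph_finite[OF assms]
  by (simp add: gl_index_def sum.Plus sum.Sigma o_def case_prod_unfold)

lemma sum_of_bool_mem:
  "finite A \<Longrightarrow> (\<Sum>v\<in>A. of_bool (P v) :: real) = card {v \<in> A. P v}"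
  by (simp add: of_bool_def sum.If_cases Int_def)

text \<open>An edge has two roots, a cocktail party vertex one. These counts reappear as the
  eigenfunction \<open>gl_weight\<close>.\<close>

lemma at_root_sum:
  assumes G: "pair_graph G" and p: "p \<in> pverts (gen_line_graph G a)"
  shows "(\<Sum>v\<in>pverts G. of_bool (at_root v p) :: real) = (case p of Line e \<Rightarrow> 2 | Party v x \<Rightarrow> 1)"
proof (cases p rule: gl_vertex_cases)
  case (Line e)
  then obtain u v where e: "e = {u, v}" "u \<noteq> v" "u \<in> pverts G" "v \<in> pverts G"
    using edge_setE[OF G, of e] p by auto
  then have "{x \<in> pverts G. x \<in> e} = e" by auto
  moreover have "card e = 2" using e by simp
  ultimately show ?thesis using Line by (simp add: sum_of_bool_mem[OF pair_graph_finite[OF G]])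
next
  case (Party v i b)
  then have "{x \<in> pverts G. v = x} = {v}" using p by auto
  then show ?thesis using Party by (simp add: sum_of_bool_mem[OF pair_graph_finite[OF G]])
qed

text \<open>Root coordinates count common roots. Two vertices in one part also meet in a petal
  coordinate, which adds 1 for equal vertices and subtracts 1 for the nonadjacent pair, giving 2 and
  0; distinct parts at one root keep the value 1.\<close>

lemma gen_line_graph_gram:
  assumes G: "pair_graph G"
  shows "gram_graph (gen_line_graph G a) (gl_index G a) gl_coord"
proof
  let ?H = "gen_line_graph G a"
  have finG: "finite (pverts G)" using pair_graph_finite[OF G] .
  show "finite (pverts ?H)" using gen_line_graph_finite[OF G] .
  show "finite (gl_index G a)" using finG by (auto simp: gl_index_def)
  fix p q assume pq: "p \<in> pverts ?H" "q \<in> pverts ?H"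
  have split: "(\<Sum>c\<in>gl_index G a. gl_coord c p * gl_coord c q)
     = card {v \<in> pverts G. at_root v p \<and> at_root v q}
       + (\<Sum>v\<in>pverts G. \<Sum>i<a v. gl_coord (Inr (v, i)) p * gl_coord (Inr (v, i)) q)"
    by (simp add: gl_index_sum[OF G] sum_of_bool_mem[OF finG] flip: of_bool_conj)
  show "(\<Sum>c\<in>gl_index G a. gl_coord c p * gl_coord c q) = adj ?H p q + 2 * of_bool (p = q)"
  proof (cases p rule: gl_vertex_cases)
    case p: (Line e)
    show ?thesis
    proof (cases q rule: gl_vertex_cases)
      case q: (Line f)
      have "{v \<in> pverts G. v \<in> e \<and> v \<in> f} = e \<inter> f"
        using edge_setE[OF G, of e] pq(1) p by auto
      then show ?thesis using pq card_edge_inter[OF G, of e f]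
        unfolding split by (simp add: p q adj_def)
    next
      case q: (Party u j b)
      have "{v \<in> pverts G. v \<in> e \<and> u = v} = (if u \<in> e then {u} else {})" using pq q by auto
      then show ?thesis using pq unfolding split by (simp add: p q adj_def)
    qed
  next
    case p: (Party v i b)
    show ?thesis
    proof (cases q rule: gl_vertex_cases)
      case q: (Line f)
      have "{u \<in> pverts G. v = u \<and> u \<in> f} = (if v \<in> f then {v} else {})" using pq p by auto
      then show ?thesis using pq unfolding split by (simp add: p q adj_def)
    next
      case q: (Party u j c)
      have card: "{x \<in> pverts G. v = x \<and> u = x} = (if u = v then {v} else {})" using pq p by auto
      let ?K = "of_bool (u = v \<and> i = j) * (if b = c then 1 else - 1) :: real"
      have "gl_coord (Inr (x, l)) p * gl_coord (Inr (x, l)) q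
          = (if x = v then if l = i then ?K else 0 else 0)" for x l
        by (auto simp: p q)
      then have "(\<Sum>x\<in>pverts G. \<Sum>l<a x. gl_coord (Inr (x, l)) p * gl_coord (Inr (x, l)) q)
          = (\<Sum>x\<in>pverts G. if x = v then (\<Sum>l<a x. if l = i then ?K else 0) else 0)"
        by (intro sum.cong refl) simp
      also have "\<dots> = ?K" using pq p finG by simp
      finally show ?thesis using pq unfolding split by (auto simp: p q adj_def card)
    qed
  qed
qed

lemma gl_index_mem [simp]:
  "Inl v \<in> gl_index G a \<longleftrightarrow> v \<in> pverts G"
  "Inr (v, i) \<in> gl_index G a \<longleftrightarrow> v \<in> pverts G \<and> i < a v"
  by (auto simp: gl_index_def)

lemma gl_image_root:
  assumes G: "pair_graph G" and v: "v \<in> pverts G"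
  shows "gram_graph.gram_image (gen_line_graph G a) gl_coord x (Inl v) =
    (\<Sum>e | e \<in> edge_set G \<and> v \<in> e. x (Line e)) +
    (\<Sum>i<a v. x (Party v (i, False)) + x (Party v (i, True)))"
proof -
  interpret gram_graph "gen_line_graph G a" "gl_index G a" gl_coord
    by (rule gen_line_graph_gram[OF G])
  have "(\<Sum>e\<in>edge_set G. of_bool (v \<in> e) * x (Line e)) = (\<Sum>e | e \<in> edge_set G \<and> v \<in> e. x (Line e))"
    unfolding sum.inter_filter[OF finite_edge_set[OF G]] by (intro sum.cong refl) simp
  moreover have "(\<Sum>u\<in>pverts G. \<Sum>i<a u. of_bool (u = v) * x (Party u (i, False))
        + of_bool (u = v) * x (Party u (i, True)))
      = (\<Sum>u\<in>pverts G. if u = v then (\<Sum>i<a u. x (Party u (i, False)) + x (Party u (i, True))) else 0)"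
    by (intro sum.cong refl) simp
  ultimately show ?thesis
    using v pair_graph_finite[OF G] by (simp add: gram_image_def gen_line_graph_sum[OF G])
qed

lemma gl_image_petal:
  assumes G: "pair_graph G" and v: "v \<in> pverts G" "i < a v"
  shows "gram_graph.gram_image (gen_line_graph G a) gl_coord x (Inr (v, i)) =
    x (Party v (i, False)) - x (Party v (i, True))"
proof -
  interpret gram_graph "gen_line_graph G a" "gl_index G a" gl_coord
    by (rule gen_line_graph_gram[OF G])
  have coord: "gl_coord (Inr (v, i)) (Party u (j, False)) * x (Party u (j, False))
        + gl_coord (Inr (v, i)) (Party u (j, True)) * x (Party u (j, True))
      = (if u = v then if j = i then x (Party u (j, False)) - x (Party u (j, True)) else 0 else 0)"
    for u j by simp
  have "gram_image x (Inr (v, i)) =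
      (\<Sum>u\<in>pverts G. \<Sum>j<a u. gl_coord (Inr (v, i)) (Party u (j, False)) * x (Party u (j, False))
        + gl_coord (Inr (v, i)) (Party u (j, True)) * x (Party u (j, True)))"
    by (simp only: gram_image_def gen_line_graph_sum[OF G] gl_coord.simps(2) mult_zero_left
        sum.neutral_const add_0_left)
  also have "\<dots> = (\<Sum>u\<in>pverts G. \<Sum>j<a u.
        if u = v then if j = i then x (Party u (j, False)) - x (Party u (j, True)) else 0 else 0)"
    by (simp only: coord)
  also have "\<dots> = (\<Sum>u\<in>pverts G. if u = v then (\<Sum>j<a u. if j = i
          then x (Party u (j, False)) - x (Party u (j, True)) else 0) else 0)"
    by (intro sum.cong refl) simp
  also have "\<dots> = x (Party v (i, False)) - x (Party v (i, True))"
    using v pair_graph_finite[OF G] by simp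
  finally show ?thesis .
qed

text \<open>Only one vertex of each part is taken, because the two vertices of a part are not
  adjacent.\<close>

definition root_clique :: "'a pair_pre_digraph \<Rightarrow> ('a \<Rightarrow> nat) \<Rightarrow> 'a \<Rightarrow> 'a gl_vertex set" where
  "root_clique G a v = Line ` {e \<in> edge_set G. v \<in> e} \<union> (\<lambda>i. Party v (i, False)) ` {..<a v}"

lemma card_root_clique:
  assumes "pair_graph G"
  shows "card (root_clique G a v) = out_degree (with_proj G) v + a v"
proof -
  have "card (root_clique G a v) = card (Line ` {e \<in> edge_set G. v \<in> e})
      + card ((\<lambda>i. Party v (i, False)) ` {..<a v})"
    unfolding root_clique_def using finite_edge_set[OF assms] by (intro card_Un_disjoint) auto
  then show ?thesis
    by (simp add: card_image inj_on_def card_incident_edges[OF assms])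
qed

lemma root_clique_subset: "v \<in> pverts G \<Longrightarrow> root_clique G a v \<subseteq> pverts (gen_line_graph G a)"
  by (auto simp: root_clique_def)

lemma root_clique_pairwise:
  "v \<in> pverts G \<Longrightarrow> pairwise (\<lambda>p q. (p, q) \<in> parcs (gen_line_graph G a)) (root_clique G a v)"
  by (auto simp: root_clique_def pairwise_def)

subsection \<open>Hoffman colorings force a balanced representation\<close>

context
  fixes G :: "'a pair_pre_digraph" and a :: "'a \<Rightarrow> nat" and k :: nat
    and w :: "'a gl_vertex \<Rightarrow> real" and f :: "'a gl_vertex \<Rightarrow> nat"
  assumes G: "pair_graph G"
    and w: "eigenfunction (gen_line_graph G a) (2 * real k - 2) w"
    and w_pos: "\<And>p. p \<in> pverts (gen_line_graph G a) \<Longrightarrow> w p > 0"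
    and f: "proper_coloring (gen_line_graph G a) k f"
begin

text \<open>In the coordinate \<open>Inr (v, i)\<close> the two vertices have opposite signs. If
  their colors differed, the images of their color classes would be positive and negative there,
  against \<open>coloring_equitable\<close>.\<close>

lemma hoffman_coloring_petal:
  assumes v: "v \<in> pverts G" "i < a v"
  shows "f (Party v (i, False)) = f (Party v (i, True))"
proof (rule ccontr)
  interpret gram_graph "gen_line_graph G a" "gl_index G a" gl_coord
    by (rule gen_line_graph_gram[OF G])
  let ?p = "Party v (i, False)" and ?q = "Party v (i, True)"
  assume ne: "f ?p \<noteq> f ?q"
  have "f ?p < k" "f ?q < k" using f v by (auto simp: proper_coloring_iff)
  moreover have "Inr (v, i) \<in> gl_index G a" using v by simp
  ultimately have "w ?p = - w ?q"
    using coloring_equitable[OF w f, of "Inr (v, i)" "f ?p" "f ?q"] ne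
    unfolding gl_image_petal[where a = a, OF G v] by simp
  then show False using w_pos[of ?p] w_pos[of ?q] v by simp
qed

text \<open>Some color class has a positive image in the coordinate \<open>Inl v\<close>; by
  \<open>coloring_equitable\<close> all k of them do, so every color occurs at \<open>v\<close>. On
  the clique at \<open>v\<close> each color then occurs exactly once.\<close>

lemma hoffman_coloring_root:
  assumes v: "v \<in> pverts G" and ne: "out_degree (with_proj G) v + a v > 0"
  shows "out_degree (with_proj G) v + a v = k"
proof -
  interpret gram_graph "gen_line_graph G a" "gl_index G a" gl_coord
    by (rule gen_line_graph_gram[OF G])
  let ?K = "root_clique G a v" and ?V = "pverts (gen_line_graph G a)"
  have "?K \<noteq> {}" using ne card_root_clique[OF G, of a v] by auto
  then obtain q where q: "q \<in> ?K" by blast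
  then have qV: "q \<in> ?V" using root_clique_subset[OF v] by blast
  have "at_root v q" using q by (auto simp: root_clique_def)
  then have pos: "gram_image (\<lambda>p. w p * of_bool (f p = f q)) (Inl v) > 0"
    unfolding gram_image_def using qV w_pos finite_verts
    by (intro sum_pos2[of _ q]) (auto simp: less_imp_le)
  have "i \<in> f ` ?K" if "i < k" for i
  proof -
    have "f q < k" using f qV by (simp add: proper_coloring_iff)
    then have "gram_image (\<lambda>p. w p * of_bool (f p = i)) (Inl v) > 0"
      using pos coloring_equitable[OF w f, of "Inl v" "f q" i] that v by simp
    then have "gram_image (\<lambda>p. w p * of_bool (f p = i)) (Inl v) \<noteq> 0" by simp
    then obtain p where "p \<in> ?V" "gl_coord (Inl v) p * (w p * of_bool (f p = i)) \<noteq> 0"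
      unfolding gram_image_def by (rule sum.not_neutral_contains_not_neutral)
    then have p: "p \<in> ?V" "at_root v p" "f p = i" by auto
    show ?thesis
    proof (cases p rule: gl_vertex_cases)
      case (Line e)
      then have "p \<in> ?K" using p by (auto simp: root_clique_def)
      then show ?thesis using p by blast
    next
      case (Party u j b)
      \<comment> \<open>The clique holds only the \<open>False\<close> vertex of a part, which has
        the same color by \<open>hoffman_coloring_petal\<close>.\<close>
      then have "Party v (j, False) \<in> ?K" "f (Party v (j, False)) = i"
        using p hoffman_coloring_petal[of v j] by (cases b; auto simp: root_clique_def)+
      then show ?thesis by blast
    qed
  qed
  moreover have "f ` ?K \<subseteq> {..<k}"
    using f root_clique_subset[OF v, of a] by (auto simp: proper_coloring_iff)
  ultimately have "f ` ?K = {..<k}" by auto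
  moreover have "inj_on f ?K"
    using proper_coloring_inj_on_clique[OF f root_clique_pairwise[OF v]] .
  ultimately have "card ?K = k" by (metis card_image card_lessThan)
  then show ?thesis by (simp add: card_root_clique[OF G])
qed

end

subsection \<open>Dropping roots without edges and petals\<close>

text \<open>A root with no edges and no parts is invisible in the generalized line graph, yet
  \<open>balanced_line_graph\<close> would attach c parts to it. Such roots are removed before the
  balanced form is read off.\<close>

definition restrict_roots :: "'a pair_pre_digraph \<Rightarrow> ('a \<Rightarrow> nat) \<Rightarrow> 'a pair_pre_digraph" where
  "restrict_roots G a = \<lparr>pverts = {v \<in> pverts G. out_degree (with_proj G) v + a v > 0}, parcs = parcs G\<rparr>"

lemma out_degree_restrict_roots:
  "out_degree (with_proj (restrict_roots G a)) v = out_degree (with_proj G) v"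
  by (simp add: out_degree_def out_arcs_def restrict_roots_def)

lemma pair_graph_restrict_roots:
  assumes "pair_graph G"
  shows "pair_graph (restrict_roots G a)"
proof -
  interpret pair_graph G by fact
  have deg: "out_degree (with_proj G) u > 0" if "(u, v) \<in> parcs G" for u v
  proof -
    have "(u, v) \<in> {e \<in> parcs G. fst e = u}" using that by simp
    then show ?thesis
      using pair_finite_arcs by (auto simp: out_degree_def out_arcs_def card_gt_0_iff)
  qed
  show ?thesis
  proof
    fix e assume e: "e \<in> parcs (restrict_roots G a)"
    then have e1: "(fst e, snd e) \<in> parcs G" by (simp add: restrict_roots_def)
    note e2 = arcs_symmetric[OF e1]
    show "fst e \<in> pverts (restrict_roots G a)" "snd e \<in> pverts (restrict_roots G a)"
      using wellformed'[OF e1] deg[OF e1] deg[OF e2] by (auto simp: restrict_roots_def)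
    show "fst e \<noteq> snd e" using e1 no_loops' by blast
  next
    show "symmetric (with_proj (restrict_roots G a))"
      using pair_sym_arcs by (simp add: symmetric_def restrict_roots_def)
  qed (auto simp: restrict_roots_def pair_finite_verts pair_finite_arcs)
qed

text \<open>The counts \<open>a\<close> and \<open>b\<close> are compared on surviving roots only,
  since k minus the degree need not agree with \<open>a\<close> at a removed root.\<close>

lemma gen_line_graph_restrict_roots:
  assumes G: "pair_graph G"
    and b: "\<And>v. v \<in> pverts (restrict_roots G a) \<Longrightarrow> b v = a v"
  shows "gen_line_graph (restrict_roots G a) b = gen_line_graph G a"
proof -
  let ?G = "restrict_roots G a"
  have es: "edge_set ?G = edge_set G" by (simp add: edge_set_def restrict_roots_def)
  have root: "v \<in> pverts ?G \<and> i < b v \<longleftrightarrow> v \<in> pverts G \<and> i < a v" for v i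
    using b[of v] by (auto simp: restrict_roots_def)
  have "p \<in> pverts (gen_line_graph ?G b) \<longleftrightarrow> p \<in> pverts (gen_line_graph G a)" for p
    by (cases p rule: gl_vertex_cases) (simp_all add: es root)
  moreover have "(p, q) \<in> parcs (gen_line_graph ?G b) \<longleftrightarrow> (p, q) \<in> parcs (gen_line_graph G a)" for p q
    using root
    by (cases p rule: gl_vertex_cases; cases q rule: gl_vertex_cases) (auto simp: es)
  ultimately show ?thesis by (intro pair_pre_digraph.equality) auto
qed

lemma line_graph_coloring:
  assumes "proper_coloring (gen_line_graph G a) k f"
  shows "proper_coloring (line_graph G) k (f \<circ> Line)"
  using assms by (auto simp: proper_coloring_iff line_graph_def)

text \<open>By \<open>hoffman_coloring_root\<close>, each surviving root has as many parts as its
  edges leave colors. The same coloring, restricted to edges, bounds the chromatic number of the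
  line graph.\<close>

lemma hoffman_imp_balanced:
  assumes G: "pair_graph G" and k: "k = chromatic_number (gen_line_graph G a)"
    and w: "eigenfunction (gen_line_graph G a) (2 * real k - 2) w"
    and w_pos: "\<And>p. p \<in> pverts (gen_line_graph G a) \<Longrightarrow> w p > 0"
  shows "pair_graph (restrict_roots G a)" "chromatic_number (line_graph (restrict_roots G a)) \<le> k"
    "balanced_line_graph (restrict_roots G a) k = gen_line_graph G a"
proof -
  obtain f where f: "proper_coloring (gen_line_graph G a) k f"
    using chromatic_number_coloring[OF gen_line_graph_wf gen_line_graph_finite[OF G] gen_line_graph_loopfree]
      k by blast
  show "pair_graph (restrict_roots G a)" by (rule pair_graph_restrict_roots[OF G])
  show eq: "balanced_line_graph (restrict_roots G a) k = gen_line_graph G a"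
    unfolding balanced_line_graph_def
  proof (rule gen_line_graph_restrict_roots[OF G])
    fix v assume "v \<in> pverts (restrict_roots G a)"
    then have "out_degree (with_proj G) v + a v = k"
      using hoffman_coloring_root[OF G w w_pos f] by (simp add: restrict_roots_def)
    then show "k - out_degree (with_proj (restrict_roots G a)) v = a v"
      by (simp add: out_degree_restrict_roots)
  qed
  show "chromatic_number (line_graph (restrict_roots G a)) \<le> k"
    using chromatic_number_le[OF line_graph_coloring] f eq unfolding balanced_line_graph_def by metis
qed

subsection \<open>Balanced generalized line graphs are Hoffman colorable\<close>

text \<open>The number of roots of a vertex: the transpose of \<open>gl_coord\<close> applied to the
  indicator of the root coordinates. In the balanced case this is the Perron eigenfunction.\<close>

definition gl_weight :: "'a gl_vertex \<Rightarrow> real" where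
  "gl_weight p = (case p of Line e \<Rightarrow> 2 | Party v x \<Rightarrow> 1)"

lemma gl_weight_simps [simp]: "gl_weight (Line e) = 2" "gl_weight (Party v x) = 1"
  by (simp_all add: gl_weight_def)

lemma gl_weight_pos: "gl_weight p > 0"
  by (simp add: gl_weight_def split: gl_vertex.split)

text \<open>The edges at \<open>v\<close> form a clique in the line graph. This keeps the
  subtraction of the degree from \<open>c\<close> from truncating.\<close>

lemma degree_le_line_coloring:
  assumes G: "pair_graph G" and g: "proper_coloring (line_graph G) c g"
  shows "out_degree (with_proj G) v \<le> c"
proof -
  have "card {e \<in> edge_set G. v \<in> e} \<le> c"
    by (rule chromatic_number_ge_clique[OF g]) (auto simp: line_graph_def pairwise_def)
  then show ?thesis by (simp add: card_incident_edges[OF G])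
qed

context
  fixes G :: "'a pair_pre_digraph" and a :: "'a \<Rightarrow> nat" and c :: nat and g :: "'a set \<Rightarrow> nat"
  assumes G: "pair_graph G"
    and g: "proper_coloring (line_graph G) c g"
    and balanced: "\<And>v. v \<in> pverts G \<Longrightarrow> out_degree (with_proj G) v + a v = c"
begin

lemma incident_colors:
  "inj_on g {e \<in> edge_set G. v \<in> e}" "g ` {e \<in> edge_set G. v \<in> e} \<subseteq> {..<c}"
  using g by (auto simp: proper_coloring_iff line_graph_def inj_on_def)

text \<open>The edges at \<open>v\<close> use as many colors as its degree, so exactly
  \<open>a v\<close> colors are free, one for each part.\<close>

lemma petal_colors_exist:
  assumes "v \<in> pverts G"
  shows "\<exists>h. bij_betw h {..<a v} ({..<c} - g ` {e \<in> edge_set G. v \<in> e})"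
proof -
  have "card ({..<c} - g ` {e \<in> edge_set G. v \<in> e}) = c - out_degree (with_proj G) v"
    using incident_colors[of v] finite_edge_set[OF G]
    by (simp add: card_Diff_subset card_image card_incident_edges[OF G])
  also have "\<dots> = a v" using balanced[OF assms] by simp
  finally show ?thesis by (intro finite_same_card_bij) auto
qed

definition petal_color :: "'a \<Rightarrow> nat \<Rightarrow> nat" where
  "petal_color v = (SOME h. bij_betw h {..<a v} ({..<c} - g ` {e \<in> edge_set G. v \<in> e}))"

lemma petal_color:
  "v \<in> pverts G \<Longrightarrow> bij_betw (petal_color v) {..<a v} ({..<c} - g ` {e \<in> edge_set G. v \<in> e})"
  unfolding petal_color_def by (rule someI_ex[OF petal_colors_exist])

text \<open>Ignoring the Boolean gives the two nonadjacent vertices of a part the same color. Every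
  color thus occurs at a root on exactly one edge or exactly one part.\<close>

definition balanced_coloring :: "'a gl_vertex \<Rightarrow> nat" where
  "balanced_coloring p = (case p of Line e \<Rightarrow> g e | Party v x \<Rightarrow> petal_color v (fst x))"

lemma balanced_coloring_simps [simp]:
  "balanced_coloring (Line e) = g e" "balanced_coloring (Party v (i, b)) = petal_color v i"
  by (simp_all add: balanced_coloring_def)

lemma balanced_coloring_proper: "proper_coloring (gen_line_graph G a) c balanced_coloring"
  unfolding proper_coloring_iff
proof (intro conjI ballI allI impI)
  have petal: "petal_color v i < c" "petal_color v i \<notin> g ` {e \<in> edge_set G. v \<in> e}"
    if "v \<in> pverts G" "i < a v" for v i
    using bij_betwE[OF petal_color[OF that(1)]] that(2) by auto
  have petal_neq: "petal_color v i \<noteq> petal_color v j"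
    if "v \<in> pverts G" "i < a v" "j < a v" "i \<noteq> j" for v i j
    using bij_betw_imp_inj_on[OF petal_color[OF that(1)]] that(2-) by (auto dest: inj_onD)
  fix p
  show "balanced_coloring p < c" if "p \<in> pverts (gen_line_graph G a)"
    using that g petal(1)
    by (cases p rule: gl_vertex_cases) (auto simp: proper_coloring_iff line_graph_def)
  fix q
  show "balanced_coloring p \<noteq> balanced_coloring q" if "(p, q) \<in> parcs (gen_line_graph G a)"
  proof (cases p rule: gl_vertex_cases)
    case p: (Line e)
    show ?thesis
    proof (cases q rule: gl_vertex_cases)
      case q: (Line e')
      then show ?thesis using that p g by (auto simp: proper_coloring_iff line_graph_def)
    next
      case q: (Party v j b)
      then have "petal_color v j \<notin> g ` {e \<in> edge_set G. v \<in> e}" "g e \<in> g ` {e \<in> edge_set G. v \<in> e}"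
        using that p petal(2)[of v j] by auto
      then show ?thesis unfolding p q balanced_coloring_simps by metis
    qed
  next
    case p: (Party v i b)
    show ?thesis
    proof (cases q rule: gl_vertex_cases)
      case q: (Line e)
      then show ?thesis using that p petal(2)[of v i] by auto
    next
      case q: (Party u j b')
      then show ?thesis using that p petal_neq[of v i j] by auto
    qed
  qed
qed

text \<open>At each root every color occurs once, on an edge of weight 2 or a part of total weight
  2, so every root coordinate of the image is twice the sum of \<open>s\<close>. Constant
  \<open>s\<close> yields the eigenvalue 2c - 2, and \<open>s\<close> with sum 0 yields -2.\<close>

lemma balanced_apply:
  assumes p: "p \<in> pverts (gen_line_graph G a)"
  shows "(\<Sum>q\<in>pverts (gen_line_graph G a). adj (gen_line_graph G a) p q * (gl_weight q * s (balanced_coloring q)))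
    + 2 * (gl_weight p * s (balanced_coloring p)) = 2 * (\<Sum>i<c. s i) * gl_weight p"
proof -
  interpret gram_graph "gen_line_graph G a" "gl_index G a" gl_coord
    by (rule gen_line_graph_gram[OF G])
  let ?y = "\<lambda>p. gl_weight p * s (balanced_coloring p)"
  have root: "gram_image ?y (Inl v) = 2 * (\<Sum>i<c. s i)" if v: "v \<in> pverts G" for v
  proof -
    let ?E = "{e \<in> edge_set G. v \<in> e}"
    have "(\<Sum>i<c. s i) = (\<Sum>i\<in>g ` ?E. s i) + (\<Sum>i\<in>{..<c} - g ` ?E. s i)"
      using sum.subset_diff[OF incident_colors(2)[of v] finite_lessThan, of s] by simp
    also have "(\<Sum>i\<in>g ` ?E. s i) = (\<Sum>e\<in>?E. s (g e))"
      by (subst sum.reindex[OF incident_colors(1)]) simp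
    also have "(\<Sum>i\<in>{..<c} - g ` ?E. s i) = (\<Sum>i<a v. s (petal_color v i))"
      using sum.reindex_bij_betw[OF petal_color[OF v], of s] by simp
    finally show ?thesis
      by (simp add: gl_image_root[OF G v] sum_distrib_left)
  qed
  \<comment> \<open>The two vertices of a part agree in weight and color, so they cancel.\<close>
  have petal: "gram_image ?y (Inr (v, i)) = 0" if "v \<in> pverts G" "i < a v" for v i
    by (simp add: gl_image_petal[where a = a, OF G that])
  have "(\<Sum>v\<in>gl_index G a. gl_coord v p * gram_image ?y v)
      = (\<Sum>v\<in>pverts G. of_bool (at_root v p) * (2 * (\<Sum>i<c. s i)))"
    unfolding gl_index_sum[OF G] by (simp add: root petal)
  also have "\<dots> = 2 * (\<Sum>i<c. s i) * gl_weight p"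
    by (simp add: sum_distrib_right[symmetric] at_root_sum[OF G p] gl_weight_def)
  finally show ?thesis unfolding gram_apply[OF p] .
qed

lemma balanced_hoffman:
  assumes arcs: "parcs (gen_line_graph G a) \<noteq> {}"
  shows "hoffman_colorable (gen_line_graph G a)" "lambda_min (gen_line_graph G a) = - 2"
proof -
  let ?H = "gen_line_graph G a"
  interpret gram_graph ?H "gl_index G a" gl_coord
    by (rule gen_line_graph_gram[OF G])
  note f = balanced_coloring_proper
  obtain p q where pq: "(p, q) \<in> parcs ?H" using arcs by auto
  have p: "p \<in> pverts ?H" and q: "q \<in> pverts ?H"
    using pair_wf_digraph.wellformed'[OF gen_line_graph_wf pq] by auto
  obtain v where v: "v \<in> pverts G"
    using p by (cases p rule: gl_vertex_cases) (auto elim: edge_setE[OF G])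
  have "balanced_coloring p < c" "balanced_coloring q < c" "balanced_coloring p \<noteq> balanced_coloring q"
    using f pq p q by (auto simp: proper_coloring_iff)
  \<comment> \<open>The arc forces two colors, so that 0 and 1 are both available when
    \<open>s\<close> is defined below.\<close>
  then have c: "c \<ge> 2" by linarith
  have "chromatic_number ?H \<le> c" using chromatic_number_le[OF f] .
  moreover obtain f' where f': "proper_coloring ?H (chromatic_number ?H) f'"
    using chromatic_number_coloring[OF gen_line_graph_wf gen_line_graph_finite[OF G] gen_line_graph_loopfree]
    by blast
  \<comment> \<open>By balance the clique at \<open>v\<close> has exactly c vertices.\<close>
  have "c \<le> chromatic_number ?H"
    using chromatic_number_ge_clique[OF f' root_clique_subset[OF v] root_clique_pairwise[OF v]]
      balanced[OF v] by (simp add: card_root_clique[OF G])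
  ultimately have \<chi>: "chromatic_number ?H = c" by simp
  have "eigenfunction ?H (2 * real c - 2) gl_weight"
    unfolding eigenfunction_def
  proof
    fix u assume "u \<in> pverts ?H"
    from balanced_apply[OF this, of "\<lambda>_. 1"]
    show "(\<Sum>v\<in>pverts ?H. adj ?H u v * gl_weight v) = (2 * real c - 2) * gl_weight u"
      by (simp add: algebra_simps)
  qed
  then have max: "lambda_max ?H = 2 * real c - 2"
    using p gl_weight_pos by (intro lambda_max_eqI[OF finite_verts]) auto
  \<comment> \<open>The difference of two color classes: the values sum to 0 over all colors, which
    makes -2 an eigenvalue.\<close>
  define s :: "nat \<Rightarrow> real" where "s i = of_bool (i = 0) - of_bool (i = 1)" for i
  have s: "(\<Sum>i<c. s i) = 0"
    using c by (simp add: s_def sum_subtractf of_bool_def)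
  let ?y = "\<lambda>p. gl_weight p * s (balanced_coloring p)"
  have "eigenfunction ?H (- 2) ?y"
    unfolding eigenfunction_def
  proof
    fix u assume "u \<in> pverts ?H"
    from balanced_apply[OF this, of s] s
    show "(\<Sum>v\<in>pverts ?H. adj ?H u v * ?y v) = - 2 * ?y u" by simp
  qed
  \<comment> \<open>Color 0 occurs at \<open>v\<close>, on an edge or on a part, and
    \<open>?y\<close> is positive there.\<close>
  moreover obtain u where "u \<in> pverts ?H" "?y u \<noteq> 0"
  proof (cases "0 \<in> g ` {e \<in> edge_set G. v \<in> e}")
    case True
    then obtain e where "e \<in> edge_set G" "g e = 0" by auto
    then show ?thesis using that[of "Line e"] by (simp add: s_def)
  next
    case False
    then have "0 \<in> {..<c} - g ` {e \<in> edge_set G. v \<in> e}" using c by simp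
    then obtain i where "i < a v" "petal_color v i = 0"
      using bij_betw_imp_surj_on[OF petal_color[OF v]] by (metis (no_types, lifting) imageE lessThan_iff)
    then show ?thesis using that[of "Party v (i, False)"] v by (simp add: s_def)
  qed
  ultimately show min: "lambda_min ?H = - 2"
    using lambda_min_eqI[OF finite_verts] eigenvalue_ge by blast
  show "hoffman_colorable ?H"
    unfolding hoffman_colorable_def using arcs \<chi> max min by (simp add: field_simps)
qed

end

section \<open>The equivalence, transferred along an isomorphism\<close>

theorem mainTheorem3:
  fixes GL :: "'a pair_pre_digraph"
  assumes "pair_graph GL"
    and "parcs GL \<noteq> {}"
    and "Digraph_Component.connected (with_proj GL)"
    and "is_generalized_line_graph GL"
  shows "hoffman_colorable GL \<and> lambda_min GL = - 2 \<longleftrightarrow> is_chromatically_balanced GL"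
proof
  have fin: "finite (pverts GL)" using pair_graph_finite[OF assms(1)] .
  have wf: "pair_wf_digraph GL"
    using assms(1) by (meson pair_graph.axioms(1) pair_digraph.axioms(1) pair_fin_digraph.axioms(1))
  {
    assume hoff: "hoffman_colorable GL \<and> lambda_min GL = - 2"
    obtain G :: "nat pair_pre_digraph" and a where G: "pair_graph G"
      and iso: "digraph_iso (with_proj GL) (with_proj (gen_line_graph G a))"
      using assms(4) by (auto simp: is_generalized_line_graph_def)
    obtain \<phi> where \<phi>: "graph_iso \<phi> GL (gen_line_graph G a)"
      using digraph_iso_imp_graph_iso[OF iso] .
    define k where "k = chromatic_number (gen_line_graph G a)"
    obtain w \<mu> where w: "eigenfunction GL \<mu> w" "\<And>u. u \<in> pverts GL \<Longrightarrow> w u > 0"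
      using positive_eigenfunction_exists[OF assms(1,3)] by blast
    have "pverts GL \<noteq> {}" using assms(2) pair_wf_digraph.wellformed'[OF wf] by fastforce
    \<comment> \<open>The positive eigenfunction belongs to \<open>lambda_max\<close>, and Hoffman
      colorability with least eigenvalue -2 reads k = 1 + lambda_max / 2.\<close>
    then have "\<mu> = 2 * real k - 2"
      using hoff lambda_max_eqI[OF fin _ w] chromatic_number_iso[OF \<phi> wf gen_line_graph_wf]
      by (simp add: hoffman_colorable_def k_def)
    then have "eigenfunction (gen_line_graph G a) (2 * real k - 2) (w \<circ> the_inv_into (pverts GL) \<phi>)"
      using w(1) eigenfunction_iso[OF graph_iso_inv[OF \<phi>]] by simp
    moreover have "(w \<circ> the_inv_into (pverts GL) \<phi>) p > 0" if "p \<in> pverts (gen_line_graph G a)" for p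
      using that graph_iso_inv[OF \<phi>] w(2) by (auto simp: graph_iso_def dest: bij_betwE)
    ultimately show "is_chromatically_balanced GL"
      using hoffman_imp_balanced[OF G k_def] iso unfolding is_chromatically_balanced_def by metis
  next
    assume "is_chromatically_balanced GL"
    then obtain G :: "nat pair_pre_digraph" and c where G: "pair_graph G"
      and c: "chromatic_number (line_graph G) \<le> c"
      and iso: "digraph_iso (with_proj GL) (with_proj (balanced_line_graph G c))"
      by (auto simp: is_chromatically_balanced_def)
    define a where "a = (\<lambda>v. c - out_degree (with_proj G) v)"
    have H: "balanced_line_graph G c = gen_line_graph G a"
      by (simp add: balanced_line_graph_def a_def)
    obtain \<phi> where \<phi>: "graph_iso \<phi> GL (gen_line_graph G a)"
      using digraph_iso_imp_graph_iso[OF iso] unfolding H .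
    have "pair_wf_digraph (line_graph G)" by unfold_locales (auto simp: line_graph_def)
    then obtain g where "proper_coloring (line_graph G) (chromatic_number (line_graph G)) g"
      using chromatic_number_coloring[of "line_graph G"] finite_edge_set[OF G]
      by (auto simp: line_graph_def)
    \<comment> \<open>A coloring with the least number of colors is also one with c colors, some of
      them possibly idle.\<close>
    then have g: "proper_coloring (line_graph G) c g" using c by (auto simp: proper_coloring_iff)
    have "out_degree (with_proj G) v + a v = c" for v
      using degree_le_line_coloring[OF G g, of v] by (simp add: a_def)
    from balanced_hoffman[OF G g this] graph_iso_arcs_nonempty[OF \<phi> wf assms(2)]
    show "hoffman_colorable GL \<and> lambda_min GL = - 2"
      using hoffman_iso[OF \<phi> wf fin gen_line_graph_wf] by simp
  }
qed

end
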